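(* Suppose $\mathcal{X}$ is a Polish space with its Borel $\sigma$-algebra, let $Q$ be an arbitrary probability distribution on $\mathcal{X}$, and let $c\in[0,\infty)$ be a constant. Then the sublevel set $$\mathcal{S}=\{P\mid D_\alpha(P\|Q)\le c\}$$ of probability distributions $P$ on $\mathcal{X}$ is convex and compact in the topology of weak convergence for any order $\alpha\in[1,\infty]$.
   Context: The topology of weak convergence is the (metrizable) topology in which $P_n\to P$ means $\int f\,dP_n\to\int f\,dP$ for every bounded continuous $f\colon\mathcal{X}\to\mathbb{R}$. Rényi divergence: let $P,Q$ have densities $p,q$ with respect to a dominating $\sigma$-finite measure $\mu$ (whose choice is immaterial). For $\alpha\in(0,1)\cup(1,\infty)$, $D_\alpha(P\|Q)=\frac{1}{\alpha-1}\ln\int p^\alpha q^{1-\alpha}\,d\mu\in[0,\infty]$, where for $\alpha>1$ one reads $p^\alpha q^{1-\alpha}$ as $p^\alpha/q^{\alpha-1}$ with the conventions $0/0=0$ and $x/0=\infty$ for $x>0$. Further $D_1(P\|Q)=\lim_{\alpha\uparrow1}D_\alpha(P\|Q)$, which equals the Kullback-Leibler divergence, and $D_\infty(P\|Q)=\lim_{\alpha\uparrow\infty}D_\alpha(P\|Q)$ (these limits always exist in $[0,\infty]$). *)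

theory Defs
  imports "HOL-Probability.Probability"
begin

definition mixture :: "real \<Rightarrow> 'a measure \<Rightarrow> 'a measure \<Rightarrow> 'a measure" where
  "mixture t P Q = measure_of (space P) (sets P)
     (\<lambda>A. ennreal (1 - t) * emeasure P A + ennreal t * emeasure Q A)"

lemma space_mixture [simp]: "space (mixture t P Q) = space P"
  and sets_mixture [simp, measurable_cong]: "sets (mixture t P Q) = sets P"
  by (simp_all add: mixture_def)

lemma emeasure_mixture:
  assumes "sets Q = sets P" and A: "A \<in> sets P"
  shows "emeasure (mixture t P Q) A = ennreal (1 - t) * emeasure P A + ennreal t * emeasure Q A"
  unfolding mixture_def
proof (rule emeasure_measure_of_sigma[OF _ _ _ A])
  show "sigma_algebra (space P) (sets P)" ..
  show "positive (sets P) (\<lambda>A. ennreal (1 - t) * emeasure P A + ennreal t * emeasure Q A)"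
    by (simp add: positive_def)
  show "countably_additive (sets P)
          (\<lambda>A. ennreal (1 - t) * emeasure P A + ennreal t * emeasure Q A)"
    using assms(1)
    by (auto simp: countably_additive_def suminf_add[symmetric] suminf_emeasure)
qed

lemma mixture_in_prob_algebra:
  assumes P: "P \<in> space (prob_algebra M)" and Q: "Q \<in> space (prob_algebra M)"
    and t: "0 \<le> t" "t \<le> 1"
  shows "mixture t P Q \<in> space (prob_algebra M)"
proof -
  interpret P: prob_space P using P by (simp add: space_prob_algebra)
  interpret Q: prob_space Q using Q by (simp add: space_prob_algebra)
  have s: "sets Q = sets P" "sets P = sets M" using P Q by (simp_all add: space_prob_algebra)
  have "emeasure (mixture t P Q) (space P) = 1"
    using emeasure_mixture[OF s(1) sets.top, of t] sets_eq_imp_space_eq[OF s(1)] t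
      Q.emeasure_space_1 P.emeasure_space_1
    by (simp add: ennreal_plus[symmetric] del: ennreal_plus)
  then show ?thesis using s by (auto simp: space_prob_algebra intro!: prob_spaceI)
qed

text \<open>Convexity of a set of measures; \<^term>\<open>convex\<close> is not applicable because measures
  do not form a real vector space.\<close>

definition convex_measures :: "'a measure set \<Rightarrow> bool" where
  "convex_measures S \<longleftrightarrow> (\<forall>P\<in>S. \<forall>Q\<in>S. \<forall>t\<in>{0..1}. mixture t P Q \<in> S)"

text \<open>The topology of weak convergence on the Borel probability measures: the coarsest one
  making \<open>P \<mapsto> \<integral>f dP\<close> continuous for every bounded continuous \<open>f\<close>. Cf.
  \<open>limitin_weak_topology\<close> below for convergent sequences.\<close>

definition weak_topology :: "'a::topological_space measure topology" where
  "weak_topology = topology_generated_by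
     {{P \<in> space (prob_algebra borel). integral\<^sup>L P f \<in> U} | (f :: 'a \<Rightarrow> real) U.
        continuous_on UNIV f \<and> bounded (range f) \<and> open U}"

lemma topspace_weak_topology [simp]: "topspace weak_topology = space (prob_algebra borel)"
proof -
  have "\<exists>f U. space (prob_algebra borel) =
          {P \<in> space (prob_algebra borel). integral\<^sup>L P (f :: 'a \<Rightarrow> real) \<in> U} \<and>
          continuous_on UNIV f \<and> bounded (range f) \<and> open U"
    by (rule exI[of _ "\<lambda>_. 0"], rule exI[of _ UNIV]) auto
  then show ?thesis
    unfolding weak_topology_def topology_generated_by_topspace by blast
qed

lemma limitin_weak_topology:
  fixes P :: "'a::topological_space measure"
  assumes "\<And>i. X i \<in> space (prob_algebra borel)"
  shows "limitin weak_topology X P F \<longleftrightarrow>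
    P \<in> space (prob_algebra borel) \<and>
    (\<forall>f :: 'a \<Rightarrow> real. continuous_on UNIV f \<and> bounded (range f) \<longrightarrow>
       ((\<lambda>i. integral\<^sup>L (X i) f) \<longlongrightarrow> integral\<^sup>L P f) F)"
    (is "?L \<longleftrightarrow> ?R")
proof
  assume L: ?L
  show ?R
  proof (intro conjI allI impI topological_tendstoI)
    show P: "P \<in> space (prob_algebra borel)" using L by (simp add: limitin_def)
    fix f :: "'a \<Rightarrow> real" and U
    assume f: "continuous_on UNIV f \<and> bounded (range f)" and U: "open U" "integral\<^sup>L P f \<in> U"
    have "openin weak_topology {P \<in> space (prob_algebra borel). integral\<^sup>L P f \<in> U}"
      unfolding weak_topology_def using f U
      by (intro topology_generated_by_Basis) blast
    moreover have "P \<in> {P \<in> space (prob_algebra borel). integral\<^sup>L P f \<in> U}"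
      using P U by simp
    ultimately have "eventually (\<lambda>i. X i \<in> {P \<in> space (prob_algebra borel). integral\<^sup>L P f \<in> U}) F"
      using L unfolding limitin_def by blast
    then show "eventually (\<lambda>i. integral\<^sup>L (X i) f \<in> U) F"
      by eventually_elim simp
  qed
next
  assume R: ?R
  let ?B = "{{P \<in> space (prob_algebra borel). integral\<^sup>L P f \<in> U} | (f :: 'a \<Rightarrow> real) U.
        continuous_on UNIV f \<and> bounded (range f) \<and> open U}"
  have "P \<in> W \<longrightarrow> eventually (\<lambda>i. X i \<in> W) F"
    if "generate_topology_on ?B W" for W
    using that
  proof induction
    case Empty then show ?case by simp
  next
    case (Int a b) then show ?case by (auto intro: eventually_conj)
  next
    case (UN K)
    then show ?case by (fastforce elim: eventually_mono)
  next
    case (Basis s)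
    then obtain f U where s: "s = {P \<in> space (prob_algebra borel). integral\<^sup>L P f \<in> U}"
      and f: "continuous_on UNIV (f :: 'a \<Rightarrow> real) \<and> bounded (range f)" and "open U" by blast
    show ?case
    proof
      assume "P \<in> s"
      then have "eventually (\<lambda>i. integral\<^sup>L (X i) f \<in> U) F"
        using R f \<open>open U\<close> s by (auto intro: topological_tendstoD)
      then show "eventually (\<lambda>i. X i \<in> s) F"
        by eventually_elim (simp add: s assms)
    qed
  qed
  then show ?L
    using R unfolding limitin_def topspace_weak_topology
    by (auto simp: weak_topology_def openin_topology_generated_by_iff)
qed

definition ln_ennreal :: "ennreal \<Rightarrow> ereal" where
  "ln_ennreal x = (if x = 0 then -\<infinity> else if x = \<infinity> then \<infinity> else ereal (ln (enn2real x)))"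

text \<open>For \<open>\<alpha> > 1\<close> the conventions \<open>0/0 = 0\<close> and \<open>x/0 = \<infinity>\<close> for \<open>x > 0\<close> are those
  of division on \<^typ>\<open>ennreal\<close>.\<close>

definition renyi_integrand :: "real \<Rightarrow> real \<Rightarrow> real \<Rightarrow> ennreal" where
  "renyi_integrand \<alpha> x y =
     (if \<alpha> < 1 then ennreal (x powr \<alpha> * y powr (1 - \<alpha>))
      else ennreal (x powr \<alpha>) / ennreal (y powr (\<alpha> - 1)))"

definition renyi_simple_wrt ::
    "'a measure \<Rightarrow> ('a \<Rightarrow> real) \<Rightarrow> ('a \<Rightarrow> real) \<Rightarrow> real \<Rightarrow> ereal" where
  "renyi_simple_wrt \<mu> p q \<alpha> =
     ereal (1 / (\<alpha> - 1)) * ln_ennreal (\<integral>\<^sup>+x. renyi_integrand \<alpha> (p x) (q x) \<partial>\<mu>)"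

text \<open>The dominating measure is fixed to be \<open>(P + Q)/2\<close>; by \<open>renyi_simple_eq\<close> below any other
  \<open>\<sigma>\<close>-finite dominating measure gives the same value.\<close>

definition renyi_simple :: "real \<Rightarrow> 'a measure \<Rightarrow> 'a measure \<Rightarrow> ereal" where
  "renyi_simple \<alpha> P Q = (let \<mu> = mixture (1/2) P Q in
     renyi_simple_wrt \<mu> (\<lambda>x. enn2real (RN_deriv \<mu> P x)) (\<lambda>x. enn2real (RN_deriv \<mu> Q x)) \<alpha>)"

text \<open>Meaningful for orders in \<open>(0,\<infinity>]\<close> only.\<close>

definition renyi_divergence :: "ereal \<Rightarrow> 'a measure \<Rightarrow> 'a measure \<Rightarrow> ereal" where
  "renyi_divergence \<alpha> P Q =
     (if \<alpha> = 1 then Lim (at_left 1) (\<lambda>a. renyi_simple a P Q)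
      else if \<alpha> = \<infinity> then Lim at_top (\<lambda>a. renyi_simple a P Q)
      else renyi_simple (real_of_ereal \<alpha>) P Q)"

lemma renyi_integrand_scale:
  assumes "0 \<le> r" "0 \<le> x" "0 \<le> y"
  shows "renyi_integrand \<alpha> (r * x) (r * y) = ennreal r * renyi_integrand \<alpha> x y"
proof (cases "r = 0 \<or> \<alpha> < 1")
  case True
  have "r powr \<alpha> * r powr (1 - \<alpha>) = r" if "r \<noteq> 0"
    using that assms(1) by (simp add: powr_add[symmetric])
  moreover have "(r * x) powr \<alpha> * (r * y) powr (1 - \<alpha>) =
      (r powr \<alpha> * r powr (1 - \<alpha>)) * (x powr \<alpha> * y powr (1 - \<alpha>))"
    using assms by (simp add: powr_mult)
  ultimately show ?thesis using True assms
    by (cases "r = 0") (auto simp: renyi_integrand_def ennreal_mult)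
next
  case False
  then have r: "0 < r" and a: "\<not> \<alpha> < 1" using assms by auto
  show ?thesis
  proof (cases "y = 0")
    case True
    then show ?thesis using r a assms
      by (cases "x = 0") (auto simp: renyi_integrand_def ennreal_mult_top)
  next
    case False
    then have y: "0 < y" using assms by simp
    have "(r * x) powr \<alpha> / (r * y) powr (\<alpha> - 1) =
        (r powr \<alpha> / r powr (\<alpha> - 1)) * (x powr \<alpha> / y powr (\<alpha> - 1))"
      using assms by (simp add: powr_mult)
    also have "r powr \<alpha> / r powr (\<alpha> - 1) = r"
      using r by (simp add: powr_diff[symmetric])
    finally show ?thesis using r y a assms
      by (simp add: renyi_integrand_def divide_ennreal ennreal_mult[symmetric])
  qed
qed

lemma renyi_integrand_measurable [measurable]:
  assumes [measurable]: "p \<in> borel_measurable M" "q \<in> borel_measurable M"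
  shows "(\<lambda>x. renyi_integrand \<alpha> (p x) (q x)) \<in> borel_measurable M"
  unfolding renyi_integrand_def by measurable

lemma renyi_simple_eq:
  fixes p q :: "'a \<Rightarrow> real"
  assumes "sigma_finite_measure \<mu>" and "prob_space P" "prob_space Q"
    and p [measurable]: "p \<in> borel_measurable \<mu>" "\<And>x. 0 \<le> p x"
    and q [measurable]: "q \<in> borel_measurable \<mu>" "\<And>x. 0 \<le> q x"
    and P: "P = density \<mu> p" and Q: "Q = density \<mu> q"
  shows "renyi_simple \<alpha> P Q = renyi_simple_wrt \<mu> p q \<alpha>"
proof -
  interpret sigma_finite_measure \<mu> by fact
  define \<nu> where "\<nu> = mixture (1/2) P Q"
  define r where "r x = (p x + q x) / 2" for x
  have [measurable]: "r \<in> borel_measurable \<mu>" and r0: "\<And>x. 0 \<le> r x"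
    unfolding r_def using p q by auto
  have sPQ: "sets Q = sets P" "sets P = sets \<mu>" by (simp_all add: P Q)
  have "P \<in> space (prob_algebra \<mu>)" "Q \<in> space (prob_algebra \<mu>)"
    using assms sPQ by (simp_all add: space_prob_algebra)
  then have "prob_space \<nu>"
    using mixture_in_prob_algebra[of P \<mu> Q "1/2"] by (simp add: \<nu>_def space_prob_algebra)
  then interpret \<nu>: prob_space \<nu> .
  have s\<nu> [measurable_cong]: "sets \<nu> = sets \<mu>" by (simp add: \<nu>_def sPQ)
  have em: "emeasure \<nu> A = ennreal (1/2) * emeasure P A + ennreal (1/2) * emeasure Q A"
    if "A \<in> sets \<mu>" for A
    using emeasure_mixture[OF sPQ(1), of A "1/2"] that by (simp add: \<nu>_def sPQ)
  have \<nu>: "\<nu> = density \<mu> r"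
  proof (rule measure_eqI)
    fix A assume "A \<in> sets \<nu>"
    then have [measurable]: "A \<in> sets \<mu>" by (simp add: s\<nu>)
    have "emeasure \<nu> A = (\<integral>\<^sup>+x. ennreal (1/2) * (ennreal (p x) * indicator A x)
        + ennreal (1/2) * (ennreal (q x) * indicator A x) \<partial>\<mu>)"
      by (subst nn_integral_add) (auto simp: em P Q emeasure_density nn_integral_cmult)
    also have "\<dots> = (\<integral>\<^sup>+x. ennreal (r x) * indicator A x \<partial>\<mu>)"
    proof (intro nn_integral_cong)
      fix x
      have "ennreal (1/2) * ennreal (p x) + ennreal (1/2) * ennreal (q x)
          = ennreal (1/2 * p x + 1/2 * q x)"
        using p q by (simp only: ennreal_mult ennreal_plus mult_nonneg_nonneg)
      also have "1/2 * p x + 1/2 * q x = r x" by (simp add: r_def)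
      finally show "ennreal (1/2) * (ennreal (p x) * indicator A x)
          + ennreal (1/2) * (ennreal (q x) * indicator A x) = ennreal (r x) * indicator A x"
        by (cases "x \<in> A") simp_all
    qed
    finally show "emeasure \<nu> A = emeasure (density \<mu> r) A"
      by (simp add: emeasure_density)
  qed (simp add: s\<nu>)
  have key: "AE x in \<mu>. d x = r x * enn2real (RN_deriv \<nu> R x)"
    if R: "R = density \<mu> d" "finite_measure R"
      and d [measurable]: "d \<in> borel_measurable \<mu>" and d0: "\<And>x. 0 \<le> d x"
      and ac: "\<And>A. A \<in> sets \<mu> \<Longrightarrow> emeasure \<nu> A = 0 \<Longrightarrow> emeasure R A = 0" for R and d :: "'a \<Rightarrow> real"
  proof -
    interpret R: finite_measure R by fact
    have [measurable_cong]: "sets R = sets \<mu>" using R by simp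
    have [measurable]: "RN_deriv \<nu> R \<in> borel_measurable \<mu>"
      using borel_measurable_RN_deriv[of \<nu> R] by measurable
    have a: "absolutely_continuous \<nu> R"
      unfolding absolutely_continuous_def using ac
      by (auto simp: null_sets_def s\<nu> R)
    have sR: "sets R = sets \<nu>" by (simp add: s\<nu> R)
    have fin: "AE x in \<nu>. RN_deriv \<nu> R x \<noteq> \<infinity>"
      using \<nu>.RN_deriv_finite[OF R.sigma_finite_measure_axioms a sR] .
    have "R = density \<nu> (RN_deriv \<nu> R)" using \<nu>.density_RN_deriv[OF a sR] by simp
    also have "\<dots> = density \<nu> (\<lambda>x. ennreal (enn2real (RN_deriv \<nu> R x)))"
      using fin by (intro density_cong) (auto simp: less_top)
    also have "\<dots> = density \<mu> (\<lambda>x. ennreal (r x * enn2real (RN_deriv \<nu> R x)))"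
      by (simp add: \<nu> density_density_eq ennreal_mult r0)
    finally have "density \<mu> d = density \<mu> (\<lambda>x. ennreal (r x * enn2real (RN_deriv \<nu> R x)))"
      using R by simp
    then have "AE x in \<mu>. ennreal (d x) = ennreal (r x * enn2real (RN_deriv \<nu> R x))"
      by (subst (asm) density_unique_iff) auto
    then show ?thesis
      by eventually_elim (use d0 r0 in simp)
  qed
  have fP: "finite_measure P" "finite_measure Q"
    using assms(2,3) by (auto intro: prob_space.finite_measure)
  have 1: "AE x in \<mu>. p x = r x * enn2real (RN_deriv \<nu> P x)"
    by (rule key[OF P fP(1)]) (use p em in auto)
  have 2: "AE x in \<mu>. q x = r x * enn2real (RN_deriv \<nu> Q x)"
    by (rule key[OF Q fP(2)]) (use q em in auto)
  have [measurable]: "RN_deriv \<nu> P \<in> borel_measurable \<mu>" "RN_deriv \<nu> Q \<in> borel_measurable \<mu>"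
    using borel_measurable_RN_deriv[of \<nu> P] borel_measurable_RN_deriv[of \<nu> Q] by measurable
  have "(\<integral>\<^sup>+x. renyi_integrand \<alpha> (p x) (q x) \<partial>\<mu>) =
      (\<integral>\<^sup>+x. ennreal (r x) *
         renyi_integrand \<alpha> (enn2real (RN_deriv \<nu> P x)) (enn2real (RN_deriv \<nu> Q x)) \<partial>\<mu>)"
    using 1 2 by (intro nn_integral_cong_AE, eventually_elim)
      (simp add: renyi_integrand_scale[OF r0])
  also have "\<dots> = (\<integral>\<^sup>+x.
         renyi_integrand \<alpha> (enn2real (RN_deriv \<nu> P x)) (enn2real (RN_deriv \<nu> Q x)) \<partial>density \<mu> r)"
    by (subst nn_integral_density) auto
  finally show ?thesis
    by (simp add: renyi_simple_def renyi_simple_wrt_def Let_def \<nu>_def[symmetric] \<nu>[symmetric])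
qed

end

theory Submission
  imports Defs
begin

text \<open>For \<open>a \<noteq> 1\<close>, replacing \<open>x \<mapsto> x powr a\<close> by its tangents turns \<open>D\<^sub>a(P\<parallel>Q) \<le> c\<close> into a family of
  inequalities \<open>\<integral>G dP \<le> r\<close> with bounded measurable \<open>G\<close>; the orders \<open>1\<close> and \<open>\<infinity>\<close> are intersections
  over \<open>a < 1\<close> and \<open>a > 1\<close> by monotonicity in the order. Convexity is then immediate. The same
  inequalities for functions \<open>g\<close> with two values make the sublevel set uniformly absolutely
  continuous with respect to \<open>Q\<close>. Tychonoff's theorem yields compactness in the space of
  \<open>[0,1]\<close>-valued set functions, uniform absolute continuity makes every finitely additive limit a
  measure, and \<open>P \<mapsto> \<integral>g dP\<close> is continuous for setwise convergence, which is finer than weak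
  convergence.\<close>

subsection \<open>Halfspaces of probability measures\<close>

text \<open>The tangents that make the bounds sharp touch at \<open>p / q\<close>, which is only
  measurable and may be unbounded. The test functions are therefore truncations of
  \<open>p / q\<close>, and the halfspaces they define are visibly closed for setwise rather than
  for weak convergence; this is why compactness is proved in the finer setting and then pushed
  forward. Order 1 is the delicate case. A bound on the divergence of a single order
  \<open>a < 1\<close> does not stop \<open>P\<close> from charging \<open>Q\<close>-null sets: it
  only bounds the mass there by \<open>2 * (1 - a) * c / a\<close>. Uniform absolute continuity
  appears when \<open>a\<close> tends to 1, whereas one finite order above 1 already suffices for
  it. Tangents and monotonicity in the order have one source, weighted AM-GM applied pointwise to
  the densities. Monotonicity also shows that the limits in the definition of
  \<open>renyi_divergence\<close> exist.\<close>

definition bounded_measurable :: "('a::topological_space \<Rightarrow> real) \<Rightarrow> bool" where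
  "bounded_measurable g \<longleftrightarrow> g \<in> borel_measurable borel \<and> bounded (range g)"

lemma bounded_measurable_measurable: "bounded_measurable g \<Longrightarrow> g \<in> borel_measurable borel"
  by (simp add: bounded_measurable_def)

lemma bounded_measurable_bound:
  assumes "bounded_measurable g" obtains B where "\<And>x. \<bar>g x\<bar> \<le> B"
  using assms by (auto simp: bounded_measurable_def bounded_iff)

lemma bounded_measurable_const: "bounded_measurable (\<lambda>_. c)"
  by (simp add: bounded_measurable_def)

lemma bounded_measurable_cmult: "bounded_measurable g \<Longrightarrow> bounded_measurable (\<lambda>x. c * g x)"
  unfolding bounded_measurable_def bounded_iff
  by (auto simp: abs_mult intro!: exI[of _ "\<bar>c\<bar> * _"] mult_left_mono)

text \<open>A negative exponent requires \<open>g\<close> to stay away from 0, the situation of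
  orders below 1; for a nonnegative exponent \<open>0 \<le> g\<close> is enough, as for orders above
  1. The disjunction covers both uses.\<close>

lemma bounded_measurable_powr:
  assumes g: "bounded_measurable g" and e: "\<And>x. e \<le> g x" and a: "0 < e \<or> 0 \<le> e \<and> 0 \<le> a"
  shows "bounded_measurable (\<lambda>x. g x powr a)"
proof -
  have [measurable]: "g \<in> borel_measurable borel" using g by (rule bounded_measurable_measurable)
  from bounded_measurable_bound[OF g] obtain B where B: "\<And>x. \<bar>g x\<bar> \<le> B" by blast
  have "\<bar>g x powr a\<bar> \<le> B powr a + e powr a" for x
  proof (cases "0 \<le> a")
    case True
    then have "g x powr a \<le> B powr a" using B[of x] e[of x] a by (intro powr_mono2) auto
    then show ?thesis by (simp add: add_increasing2)
  next
    case False
    then have "g x powr a \<le> e powr a" using e[of x] a by (intro powr_mono2') auto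
    then show ?thesis by (simp add: add_increasing)
  qed
  then show ?thesis by (auto simp: bounded_measurable_def bounded_iff)
qed

lemma bounded_measurable_two_valued:
  assumes "A \<in> sets borel" shows "bounded_measurable (\<lambda>x. if x \<in> A then u else v :: real)"
proof -
  have "finite (range (\<lambda>x. if x \<in> A then u else v))"
    by (rule finite_subset[of _ "{u, v}"]) auto
  then show ?thesis using assms by (auto simp: bounded_measurable_def intro: finite_imp_bounded)
qed

lemma bounded_measurable_integrable:
  assumes P: "P \<in> space (prob_algebra borel)" and g: "bounded_measurable g"
  shows "integrable P g"
proof -
  interpret prob_space P using P by (simp add: space_prob_algebra)
  have [measurable_cong]: "sets P = sets borel" using P by (simp add: space_prob_algebra)
  have [measurable]: "g \<in> borel_measurable borel" using g by (rule bounded_measurable_measurable)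
  from bounded_measurable_bound[OF g] obtain B where B: "\<And>x. \<bar>g x\<bar> \<le> B" by blast
  show ?thesis
    by (rule integrable_const_bound[of _ B]) (use B in auto)
qed

text \<open>\<open>P\<close> enters only through integrals of test functions, affine in
  \<open>P\<close> and continuous for setwise convergence, so convexity and closedness can be
  settled for all families of bounded measurable functions at once.\<close>

definition halfspaces :: "(('a::topological_space \<Rightarrow> real) \<times> real) set \<Rightarrow> 'a measure set" where
  "halfspaces H = {P \<in> space (prob_algebra borel). \<forall>(G, r)\<in>H. integral\<^sup>L P G \<le> r}"

text \<open>\<open>mixture\<close> is given by its values on sets. Induction over nonnegative Borel
  functions carries the formula to \<open>nn_integral\<close>; positive and negative parts then give
  the signed case.\<close>

lemma integral_mixture:
  assumes P: "P \<in> space (prob_algebra borel)" and R: "R \<in> space (prob_algebra borel)"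
    and t: "0 \<le> t" "t \<le> 1" and g: "bounded_measurable g"
  shows "integral\<^sup>L (mixture t P R) g = (1 - t) * integral\<^sup>L P g + t * integral\<^sup>L R g"
proof -
  interpret P: prob_space P using P by (simp add: space_prob_algebra)
  interpret R: prob_space R using R by (simp add: space_prob_algebra)
  have s: "sets P = sets borel" "sets R = sets borel" using P R by (simp_all add: space_prob_algebra)
  have sp: "space P = UNIV" "space R = UNIV"
    using s by (auto dest: sets_eq_imp_space_eq)
  have [measurable]: "g \<in> borel_measurable borel" using g by (rule bounded_measurable_measurable)
  have nn: "(\<integral>\<^sup>+x. h x \<partial>mixture t P R) = ennreal (1 - t) * (\<integral>\<^sup>+x. h x \<partial>P) + ennreal t * (\<integral>\<^sup>+x. h x \<partial>R)"
    if "h \<in> borel_measurable borel" for h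
    using that
  proof (induction rule: borel_measurable_induct)
    case (cong f g)
    then show ?case by (simp cong: nn_integral_cong add: sp)
  next
    case (set A)
    then show ?case using emeasure_mixture[of R P A t] by (simp add: s)
  next
    case (mult u c)
    have [measurable]: "u \<in> borel_measurable borel" by fact
    have "u \<in> borel_measurable P" "u \<in> borel_measurable R" "u \<in> borel_measurable (mixture t P R)"
      using mult(2) s by (simp_all cong: measurable_cong_sets)
    then show ?case using mult by (simp add: nn_integral_cmult algebra_simps)
  next
    case (add u v)
    have "u \<in> borel_measurable P" "u \<in> borel_measurable R" "u \<in> borel_measurable (mixture t P R)"
      "v \<in> borel_measurable P" "v \<in> borel_measurable R" "v \<in> borel_measurable (mixture t P R)"
      using add s by (simp_all cong: measurable_cong_sets)
    then show ?case using add by (simp add: nn_integral_add algebra_simps)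
  next
    case (seq U)
    have m: "U i \<in> borel_measurable P" "U i \<in> borel_measurable R" "U i \<in> borel_measurable (mixture t P R)" for i
      using seq s by (simp_all cong: measurable_cong_sets)
    have *: "(\<integral>\<^sup>+x. (SUP i. U i) x \<partial>N) = (SUP i. \<integral>\<^sup>+x. U i x \<partial>N)"
      if "\<And>i. U i \<in> borel_measurable N" for N :: "'a measure"
      using nn_integral_monotone_convergence_SUP[OF \<open>incseq U\<close> that] by (simp add: image_comp)
    have inc: "incseq (\<lambda>i. integral\<^sup>N N (U i))" for N :: "'a measure"
      using \<open>incseq U\<close> by (auto simp: incseq_def le_fun_def intro: nn_integral_mono)
    show ?case
      unfolding *[OF m(1)] *[OF m(2)] *[OF m(3)] seq.IH SUP_mult_left_ennreal
      by (rule ennreal_SUP_add) (use inc in \<open>auto simp: incseq_def intro: mult_left_mono\<close>)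
  qed
  have M: "mixture t P R \<in> space (prob_algebra borel)"
    by (rule mixture_in_prob_algebra[OF P R t])
  have fin: "(\<integral>\<^sup>+x. ennreal (h x) \<partial>N) < \<top>"
    if "N \<in> space (prob_algebra borel)" "bounded_measurable h" for N and h :: "'a \<Rightarrow> real"
  proof -
    have "(\<integral>\<^sup>+x. ennreal (h x) \<partial>N) \<le> (\<integral>\<^sup>+x. ennreal (norm (h x)) \<partial>N)"
      by (intro nn_integral_mono ennreal_leI) simp
    also have "\<dots> < \<top>"
      using bounded_measurable_integrable[OF that] by (simp add: integrable_iff_bounded)
    finally show ?thesis .
  qed
  have g': "bounded_measurable (\<lambda>x. - g x)"
    using g by (auto simp: bounded_measurable_def bounded_iff)
  \<comment> \<open>\<open>enn2real\<close> sends infinity to 0, so its additivity rests on the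
    finiteness from \<open>fin\<close>.\<close>
  have e: "enn2real (ennreal (1 - t) * x + ennreal t * y) = (1 - t) * enn2real x + t * enn2real y"
    if "x < \<top>" "y < \<top>" for x y
    using that t by (simp add: enn2real_plus enn2real_mult ennreal_mult_less_top)
  show ?thesis
    using fin[OF P g] fin[OF P g'] fin[OF R g] fin[OF R g']
    by (simp add: real_lebesgue_integral_def bounded_measurable_integrable P R M g nn e)
      (simp add: algebra_simps)
qed

lemma convex_halfspaces:
  assumes "\<And>G r. (G, r) \<in> H \<Longrightarrow> bounded_measurable G"
  shows "convex_measures (halfspaces H)"
  unfolding convex_measures_def
proof (intro ballI)
  fix P R t assume P: "P \<in> halfspaces H" and R: "R \<in> halfspaces H" and t: "t \<in> {0..1::real}"
  then have PR: "P \<in> space (prob_algebra borel)" "R \<in> space (prob_algebra borel)"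
    by (simp_all add: halfspaces_def)
  have "integral\<^sup>L (mixture t P R) G \<le> r" if "(G, r) \<in> H" for G r
  proof -
    have "integral\<^sup>L (mixture t P R) G = (1 - t) * integral\<^sup>L P G + t * integral\<^sup>L R G"
      using integral_mixture[OF PR] t assms[OF that] by simp
    also have "\<dots> \<le> (1 - t) * r + t * r"
      using P R t that by (intro add_mono mult_left_mono) (auto simp: halfspaces_def)
    finally show ?thesis by (simp add: algebra_simps)
  qed
  then show "mixture t P R \<in> halfspaces H"
    using mixture_in_prob_algebra[OF PR] t by (auto simp: halfspaces_def)
qed

section \<open>Compactness under a uniform modulus of absolute continuity\<close>

text \<open>\<open>measure_of\<close> falls back to the zero measure when its argument is not
  countably additive. Space and sigma-algebra are thus right for every \<open>m\<close>, and only
  the values need \<open>m\<close> to be a charge.\<close>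

definition measure_of_fun :: "('a::topological_space set \<Rightarrow> real) \<Rightarrow> 'a measure" where
  "measure_of_fun m = measure_of UNIV (sets borel) (\<lambda>A. ennreal (m A))"

text \<open>\<open>\<delta>\<close> is a modulus of absolute continuity with respect to \<open>Q\<close>, uniform over the charges below;
  it makes their pointwise limits countably additive.\<close>

locale equi_ac =
  fixes Q :: "'a::topological_space measure" and \<delta> :: "real \<Rightarrow> real"
  assumes Q: "Q \<in> space (prob_algebra borel)" and \<delta>: "\<And>\<epsilon>. 0 < \<epsilon> \<Longrightarrow> 0 < \<delta> \<epsilon>"
begin

text \<open>Setwise convergence. Points are extensional functions, equal to \<open>undefined\<close>
  off the Borel sets.\<close>

definition charge_topology :: "('a set \<Rightarrow> real) topology" where
  "charge_topology = product_topology (\<lambda>_. top_of_set {0..1}) (sets borel)"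

text \<open>Each clause constrains finitely many values of \<open>m\<close> by an equation or a
  non-strict inequality, hence is closed for pointwise convergence. Countable additivity is not of
  this form; \<open>emeasure_charge\<close> recovers it.\<close>

definition charges :: "('a set \<Rightarrow> real) set" where
  "charges = {m \<in> topspace charge_topology. m UNIV = 1 \<and>
     (\<forall>A\<in>sets borel. \<forall>B\<in>sets borel. A \<inter> B = {} \<longrightarrow> m (A \<union> B) = m A + m B) \<and>
     (\<forall>\<epsilon>>0. \<forall>A\<in>sets borel. measure Q A < \<delta> \<epsilon> \<longrightarrow> m A \<le> \<epsilon>)}"

lemma continuous_map_eval:
  "A \<in> sets borel \<Longrightarrow> continuous_map charge_topology euclideanreal (\<lambda>m. m A)"
  unfolding charge_topology_def
  using continuous_map_product_projection[of A "sets borel" "\<lambda>_. top_of_set {0..1::real}"]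
  by (simp add: continuous_map_in_subtopology)

lemma closedin_charges: "closedin charge_topology charges"
proof -
  let ?X = charge_topology
  have 1: "closedin ?X {m \<in> topspace ?X. m UNIV = 1}"
    by (rule closedin_continuous_maps_eq[of euclideanreal]) (auto intro: continuous_map_eval)
  \<comment> \<open>With the side conditions inside the set, the intersection in \<open>eq\<close>
    runs over the nonempty index set \<open>UNIV\<close>; where they fail, the set is the whole
    space.\<close>
  have 2: "closedin ?X {m \<in> topspace ?X. A \<in> sets borel \<and> B \<in> sets borel \<and> A \<inter> B = {} \<longrightarrow> m (A \<union> B) = m A + m B}" for A B
  proof (cases "A \<in> sets borel \<and> B \<in> sets borel \<and> A \<inter> B = {}")
    case True
    then have "closedin ?X {m \<in> topspace ?X. m (A \<union> B) = m A + m B}"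
      by (intro closedin_continuous_maps_eq[of euclideanreal] continuous_map_eval continuous_map_add) auto
    then show ?thesis using True by simp
  next
    case False
    then have "{m \<in> topspace ?X. A \<in> sets borel \<and> B \<in> sets borel \<and> A \<inter> B = {} \<longrightarrow> m (A \<union> B) = m A + m B} = topspace ?X"
      by blast
    then show ?thesis by simp
  qed
  have 3: "closedin ?X {m \<in> topspace ?X. 0 < \<epsilon> \<and> A \<in> sets borel \<and> measure Q A < \<delta> \<epsilon> \<longrightarrow> m A \<le> \<epsilon>}" for A \<epsilon>
  proof (cases "0 < \<epsilon> \<and> A \<in> sets borel \<and> measure Q A < \<delta> \<epsilon>")
    case True
    then have "closedin ?X {m \<in> topspace ?X. m A \<in> {..\<epsilon>}}"
      by (intro closedin_continuous_map_preimage[of _ euclideanreal] continuous_map_eval) auto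
    then show ?thesis using True by simp
  next
    case False
    then have "{m \<in> topspace ?X. 0 < \<epsilon> \<and> A \<in> sets borel \<and> measure Q A < \<delta> \<epsilon> \<longrightarrow> m A \<le> \<epsilon>} = topspace ?X"
      by blast
    then show ?thesis by simp
  qed
  have eq: "charges = {m \<in> topspace ?X. m UNIV = 1} \<inter>
     (\<Inter>(A, B)\<in>UNIV. {m \<in> topspace ?X. A \<in> sets borel \<and> B \<in> sets borel \<and> A \<inter> B = {} \<longrightarrow> m (A \<union> B) = m A + m B}) \<inter>
     (\<Inter>(A, \<epsilon>)\<in>UNIV. {m \<in> topspace ?X. 0 < \<epsilon> \<and> A \<in> sets borel \<and> measure Q A < \<delta> \<epsilon> \<longrightarrow> m A \<le> \<epsilon>})"
    unfolding charges_def by blast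
  show ?thesis
    unfolding eq using 1 2 3 by (intro closedin_Int closedin_INT) auto
qed

lemma compactin_charges: "compactin charge_topology charges"
proof -
  have "compact_space charge_topology"
    unfolding charge_topology_def compact_space_product_topology
    by (simp add: compact_space_subtopology)
  then show ?thesis using closedin_charges by (rule closedin_compact_space)
qed

lemma charge_range: "m \<in> charges \<Longrightarrow> A \<in> sets borel \<Longrightarrow> 0 \<le> m A \<and> m A \<le> 1"
  unfolding charges_def charge_topology_def by (auto simp: PiE_iff)

text \<open>Finite additivity and continuity at the empty set: along Borel sets decreasing to
  \<open>{}\<close> the \<open>Q\<close>-measures tend to 0, and the modulus forces \<open>m\<close>
  to follow.\<close>

lemma emeasure_charge:
  assumes m: "m \<in> charges" and A: "A \<in> sets borel"
  shows "emeasure (measure_of_fun m) A = ennreal (m A)"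
  unfolding measure_of_fun_def
proof (rule emeasure_measure_of_sigma[OF _ _ _ A])
  interpret Q: prob_space Q using Q by (simp add: space_prob_algebra)
  have sQ: "sets Q = sets borel" using Q by (simp add: space_prob_algebra)
  have sa: "sigma_algebra UNIV (sets (borel :: 'a measure))"
    using sets.sigma_algebra_axioms[of "borel :: 'a measure"] by simp
  then show "sigma_algebra UNIV (sets (borel :: 'a measure))" .
  then interpret sigma_algebra UNIV "sets (borel :: 'a measure)" .
  have add: "m (A \<union> B) = m A + m B" if "A \<in> sets borel" "B \<in> sets borel" "A \<inter> B = {}" for A B
    using m that by (auto simp: charges_def)
  have "m {} = 0" using add[of "{}" "{}"] by simp
  then show pos: "positive (sets borel) (\<lambda>A. ennreal (m A))" by (simp add: positive_def)
  have "additive (sets borel) (\<lambda>A. ennreal (m A))"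
    using add charge_range[OF m] by (auto simp: additive_def)
  then show "countably_additive (sets borel) (\<lambda>A. ennreal (m A))"
  proof (rule empty_continuous_imp_countably_additive[OF pos])
    fix A :: "nat \<Rightarrow> 'a set"
    assume A: "range A \<subseteq> sets borel" "decseq A" "(\<Inter>i. A i) = {}"
    have lim: "(\<lambda>i. measure Q (A i)) \<longlonglongrightarrow> 0"
      using Q.finite_Lim_measure_decseq[of A] A sQ by simp
    have "(\<lambda>i. m (A i)) \<longlonglongrightarrow> 0"
    proof (rule tendstoI)
      fix e :: real assume e: "0 < e"
      \<comment> \<open>Half of \<open>e\<close>, since the modulus yields only a non-strict
        bound.\<close>
      have "eventually (\<lambda>i. measure Q (A i) < \<delta> (e/2)) sequentially"
        using order_tendstoD(2)[OF lim \<delta>] e by simp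
      then show "eventually (\<lambda>i. dist (m (A i)) 0 < e) sequentially"
      proof eventually_elim
        case (elim i)
        have Ai: "A i \<in> sets borel" using A by auto
        moreover have "\<forall>\<epsilon>>0. \<forall>A\<in>sets borel. measure Q A < \<delta> \<epsilon> \<longrightarrow> m A \<le> \<epsilon>"
          using m by (simp add: charges_def)
        then have "m (A i) \<le> e/2" using Ai elim e half_gt_zero by blast
        ultimately show ?case using charge_range[OF m, of "A i"] e by simp
      qed
    qed
    then show "(\<lambda>i. ennreal (m (A i))) \<longlonglongrightarrow> 0"
      using tendsto_ennrealI by fastforce
  qed simp
qed

lemma sets_measure_of_fun [simp, measurable_cong]: "sets (measure_of_fun m) = sets borel"
  unfolding measure_of_fun_def using sets.sigma_sets_eq[of borel] by (simp add: sets_measure_of_conv)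

lemma space_measure_of_fun [simp]: "space (measure_of_fun m) = UNIV"
  unfolding measure_of_fun_def by (simp add: space_measure_of_conv)

lemma measure_of_fun_prob:
  assumes "m \<in> charges" shows "measure_of_fun m \<in> space (prob_algebra borel)"
proof -
  have "emeasure (measure_of_fun m) UNIV = 1"
    using assms by (simp add: emeasure_charge) (simp add: charges_def)
  then show ?thesis by (auto simp: space_prob_algebra intro!: prob_spaceI)
qed

text \<open>For a function with finitely many values the integral is a finite combination of
  evaluations of \<open>m\<close>. A general \<open>g\<close> is a uniform limit of such functions,
  and since all measures have mass 1 the integrals converge uniformly in \<open>m\<close>.\<close>

lemma continuous_map_integral:
  assumes g: "bounded_measurable g"
  shows "continuous_map (subtopology charge_topology charges) euclideanreal
           (\<lambda>m. integral\<^sup>L (measure_of_fun m) g)"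
proof -
  have [measurable]: "g \<in> borel_measurable borel" using g by (rule bounded_measurable_measurable)
  from bounded_measurable_bound[OF g] obtain B where B: "\<And>x. \<bar>g x\<bar> \<le> B" by blast
  \<comment> \<open>\<open>g\<close> rounded down to a multiple of \<open>1 / Suc n\<close>;
    boundedness of \<open>g\<close> leaves finitely many values.\<close>
  define s where "s n x = of_int \<lfloor>real (Suc n) * g x\<rfloor> / real (Suc n)" for n x
  have [measurable]: "s n \<in> borel_measurable borel" for n unfolding s_def by measurable
  have sg: "\<bar>s n x - g x\<bar> \<le> 1 / real (Suc n)" for n x
  proof -
    have "s n x - g x = (of_int \<lfloor>real (Suc n) * g x\<rfloor> - real (Suc n) * g x) / real (Suc n)"
      by (simp add: s_def field_simps)
    moreover have "\<bar>of_int \<lfloor>real (Suc n) * g x\<rfloor> - real (Suc n) * g x\<bar> \<le> 1" by linarith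
    ultimately show ?thesis by (simp add: divide_right_mono)
  qed
  have fin: "finite (range (s n))" for n
  proof -
    have "range (s n) \<subseteq> (\<lambda>k. of_int k / real (Suc n)) ` {\<lfloor>- (real (Suc n) * B)\<rfloor>..\<lfloor>real (Suc n) * B\<rfloor>}"
    proof clarify
      fix x
      have "- (real (Suc n) * B) \<le> real (Suc n) * g x" "real (Suc n) * g x \<le> real (Suc n) * B"
        using B[of x] by (simp_all only: mult_minus_right[symmetric])
          (intro mult_left_mono; linarith)+
      then show "s n x \<in> (\<lambda>k. of_int k / real (Suc n)) ` {\<lfloor>- (real (Suc n) * B)\<rfloor>..\<lfloor>real (Suc n) * B\<rfloor>}"
        unfolding s_def by (intro imageI) (auto intro: floor_mono)
    qed
    then show ?thesis by (rule finite_subset) simp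
  qed
  have bs: "bounded_measurable (s n)" for n
    using fin[of n] by (auto simp: bounded_measurable_def finite_imp_bounded)
  have int_s: "integral\<^sup>L (measure_of_fun m) (s n) = (\<Sum>y\<in>range (s n). m (s n -` {y}) * y)" 
    if m: "m \<in> charges" for m n
  proof -
    interpret prob_space "measure_of_fun m"
      using measure_of_fun_prob[OF m] by (simp add: space_prob_algebra)
    have "simple_function (measure_of_fun m) (s n)"
      unfolding simple_function_def
    proof (intro conjI ballI)
      fix y show "s n -` {y} \<inter> space (measure_of_fun m) \<in> sets (measure_of_fun m)"
        using measurable_sets[of "s n" borel borel "{y}"] by simp
    qed (use fin in simp)
    then have "Bochner_Integration.simple_bochner_integrable (measure_of_fun m) (s n)"
      by (simp add: simple_bochner_integrable.simps emeasure_eq_measure)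
    then have "integral\<^sup>L (measure_of_fun m) (s n) = Bochner_Integration.simple_bochner_integral (measure_of_fun m) (s n)"
      by (rule simple_bochner_integrable_eq_integral[symmetric])
    also have "\<dots> = (\<Sum>y\<in>range (s n). measure (measure_of_fun m) (s n -` {y}) * y)"
      by (simp add: simple_bochner_integral_def vimage_def)
    also have "\<dots> = (\<Sum>y\<in>range (s n). m (s n -` {y}) * y)"
    proof (rule sum.cong[OF refl])
      fix y
      have "s n -` {y} \<in> sets borel" using measurable_sets[of "s n" borel borel "{y}"] by simp
      then show "measure (measure_of_fun m) (s n -` {y}) * y = m (s n -` {y}) * y"
        using emeasure_charge[OF m] charge_range[OF m] by (simp add: measure_def)
    qed
    finally show ?thesis .
  qed
  let ?Y = "subtopology charge_topology charges"
  have sub: "topspace ?Y = charges" by (auto simp: charges_def)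
  have cont: "continuous_map ?Y euclideanreal (\<lambda>m. integral\<^sup>L (measure_of_fun m) (s n))" for n
  proof (rule continuous_map_eq)
    show "continuous_map ?Y euclideanreal (\<lambda>m. \<Sum>y\<in>range (s n). m (s n -` {y}) * y)"
    proof (intro continuous_map_sum fin continuous_map_real_mult continuous_map_from_subtopology continuous_map_eval)
      fix y show "s n -` {y} \<in> sets borel" using measurable_sets[of "s n" borel borel "{y}"] by simp
    qed simp
  qed (use int_s sub in auto)
  have "continuous_map ?Y Met_TC.mtopology (\<lambda>m. integral\<^sup>L (measure_of_fun m) g)"
  proof (rule Met_TC.continuous_map_uniform_limit_alt[of _ "\<lambda>n m. integral\<^sup>L (measure_of_fun m) (s n)" sequentially])
    fix e :: real assume "0 < e"
    then have "eventually (\<lambda>n. 1 / real (Suc n) < e) sequentially"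
      using order_tendstoD(2)[OF LIMSEQ_inverse_real_of_nat] by (simp add: inverse_eq_divide)
    then show "eventually (\<lambda>n. \<forall>m\<in>topspace ?Y. dist (integral\<^sup>L (measure_of_fun m) (s n)) (integral\<^sup>L (measure_of_fun m) g) < e) sequentially"
    proof (eventually_elim, intro ballI)
      fix n m assume n: "1 / real (Suc n) < e" and "m \<in> topspace ?Y"
      then have m: "m \<in> charges" using sub by simp
      note P = measure_of_fun_prob[OF m]
      interpret prob_space "measure_of_fun m" using P by (simp add: space_prob_algebra)
      have "\<bar>integral\<^sup>L (measure_of_fun m) (s n) - integral\<^sup>L (measure_of_fun m) g\<bar>
          = \<bar>\<integral>x. s n x - g x \<partial>measure_of_fun m\<bar>"
        using bounded_measurable_integrable[OF P] g bs by simp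
      also have "\<dots> \<le> (\<integral>x. \<bar>s n x - g x\<bar> \<partial>measure_of_fun m)" by (rule integral_abs_bound)
      also have "\<dots> \<le> (\<integral>x. 1 / real (Suc n) \<partial>measure_of_fun m)"
        using bounded_measurable_integrable[OF P] g bs sg by (intro integral_mono) auto
      also have "\<dots> = 1 / real (Suc n)" using prob_space by simp
      finally show "dist (integral\<^sup>L (measure_of_fun m) (s n)) (integral\<^sup>L (measure_of_fun m) g) < e"
        using n by (simp add: dist_real_def)
    qed
  qed (use cont in auto)
  then show ?thesis by simp
qed

text \<open>The halfspaces, read as conditions on charges, cut out a closed subset \<open>K\<close>
  of a compact space, and \<open>measure_of_fun\<close> maps \<open>K\<close> continuously onto
  \<open>halfspaces H\<close>. Assumption \<open>ac\<close> makes it onto: it says that each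
  \<open>P\<close> in \<open>halfspaces H\<close> comes from a charge.\<close>

lemma compactin_halfspaces:
  assumes H: "\<And>G r. (G, r) \<in> H \<Longrightarrow> bounded_measurable G"
    and ac: "\<And>P A \<epsilon>. P \<in> halfspaces H \<Longrightarrow> A \<in> sets borel \<Longrightarrow> 0 < \<epsilon> \<Longrightarrow> measure Q A < \<delta> \<epsilon> \<Longrightarrow> measure P A \<le> \<epsilon>"
  shows "compactin weak_topology (halfspaces H)"
proof -
  define Y where "Y = subtopology charge_topology charges"
  have sub: "topspace Y = charges" by (auto simp: Y_def charges_def)
  note continuous = continuous_map_integral[folded Y_def]
  define K where "K = {m \<in> topspace Y. \<forall>(G, r)\<in>H. integral\<^sup>L (measure_of_fun m) G \<le> r}"
  have "closedin Y {m \<in> topspace Y. integral\<^sup>L (measure_of_fun m) G \<in> {..r}}" if "(G, r) \<in> H" for G r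
    using that H by (intro closedin_continuous_map_preimage[of _ euclideanreal] continuous) auto
  \<comment> \<open>The whole space is inserted so that the intersection is right even for empty
    \<open>H\<close>.\<close>
  then have "closedin Y (\<Inter>(insert (topspace Y) ((\<lambda>(G, r). {m \<in> topspace Y. integral\<^sup>L (measure_of_fun m) G \<in> {..r}}) ` H)))"
    by (intro closedin_Inter) auto
  also have "\<Inter>(insert (topspace Y) ((\<lambda>(G, r). {m \<in> topspace Y. integral\<^sup>L (measure_of_fun m) G \<in> {..r}}) ` H)) = K"
    unfolding K_def by auto
  finally have "closedin Y K" .
  moreover have "compact_space Y" using compactin_charges by (simp add: Y_def compact_space_subtopology)
  ultimately have K: "compactin Y K" by (metis closedin_compact_space)
  \<comment> \<open>Checked on the generating sets: a bounded continuous \<open>f\<close> is bounded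
    measurable, so its integral is already continuous setwise.\<close>
  have "continuous_map Y weak_topology measure_of_fun"
    unfolding weak_topology_def
  proof (rule continuous_on_generated_topo)
    show "measure_of_fun ` topspace Y \<subseteq> \<Union> {{P \<in> space (prob_algebra borel). integral\<^sup>L P f \<in> U} |(f :: 'a \<Rightarrow> real) U.
        continuous_on UNIV f \<and> bounded (range f) \<and> open U}"
      using measure_of_fun_prob sub topspace_weak_topology
      unfolding weak_topology_def topology_generated_by_topspace by blast
  next
    fix V assume "V \<in> {{P \<in> space (prob_algebra borel). integral\<^sup>L P f \<in> U} |(f :: 'a \<Rightarrow> real) U.
        continuous_on UNIV f \<and> bounded (range f) \<and> open U}"
    then obtain f :: "'a \<Rightarrow> real" and U where V: "V = {P \<in> space (prob_algebra borel). integral\<^sup>L P f \<in> U}"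
      and f: "continuous_on UNIV f" "bounded (range f)" and U: "open U" by blast
    have "bounded_measurable f"
      using f by (auto simp: bounded_measurable_def borel_measurable_continuous_onI)
    then have "openin Y {m \<in> topspace Y. integral\<^sup>L (measure_of_fun m) f \<in> U}"
      using U by (intro openin_continuous_map_preimage[of _ euclideanreal] continuous) auto
    also have "{m \<in> topspace Y. integral\<^sup>L (measure_of_fun m) f \<in> U} = measure_of_fun -` V \<inter> topspace Y"
      using measure_of_fun_prob sub V by auto
    finally show "openin Y (measure_of_fun -` V \<inter> topspace Y)" .
  qed
  with K have "compactin weak_topology (measure_of_fun ` K)" by (rule image_compactin)
  also have "measure_of_fun ` K = halfspaces H"
  proof (intro equalityI subsetI)
    fix P assume "P \<in> measure_of_fun ` K"
    then show "P \<in> halfspaces H"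
      using measure_of_fun_prob sub by (auto simp: K_def halfspaces_def)
  next
    fix P assume P: "P \<in> halfspaces H"
    then have P': "P \<in> space (prob_algebra borel)" by (simp add: halfspaces_def)
    then interpret P: prob_space P by (simp add: space_prob_algebra)
    have s: "sets P = sets borel" using P' by (simp add: space_prob_algebra)
    then have sp: "space P = UNIV" by (auto dest: sets_eq_imp_space_eq)
    \<comment> \<open>Restriction makes \<open>m\<close> extensional, as points of the product space
      must be.\<close>
    define m where "m = restrict (measure P) (sets borel)"
    have m: "m \<in> charges"
      using ac[OF P] P.prob_space
      by (auto simp: charges_def charge_topology_def m_def s sp P.finite_measure_Union)
    have "measure_of_fun m = P"
      by (rule measure_eqI) (simp_all add: s emeasure_charge[OF m], simp add: m_def P.emeasure_eq_measure)
    then show "P \<in> measure_of_fun ` K"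
      using m P sub unfolding K_def halfspaces_def
      by (intro image_eqI[of _ _ m]) auto
  qed
  finally show ?thesis .
qed

end

subsection \<open>Tangent and interpolation inequalities\<close>

lemma weighted_young:
  fixes s x y :: real
  assumes "0 < s" "s < 1" "0 \<le> x" "0 \<le> y"
  shows "x powr s * y powr (1 - s) \<le> s * x + (1 - s) * y"
proof (cases "x = 0 \<or> y = 0")
  case False
  then show ?thesis using Youngs_inequality_0[of s "1 - s" x y] assms by simp
qed (use assms in auto)

text \<open>Weighted AM-GM for \<open>v powr (a - 1) * x\<close> and \<open>v powr a * y\<close>:
  the powers of \<open>v\<close> cancel in the product. Equality holds at
  \<open>x = v * y\<close>.\<close>

lemma powr_tangent_lt:
  fixes a v x y :: real
  assumes "0 < a" "a < 1" "0 < v" "0 \<le> x" "0 \<le> y"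
  shows "x powr a * y powr (1 - a) \<le> a * v powr (a - 1) * x + (1 - a) * v powr a * y"
proof -
  have "v powr ((a - 1) * a) * v powr (a * (1 - a)) = v powr 0"
    by (simp add: powr_add[symmetric] algebra_simps del: powr_zero_eq_one)
  then have "x powr a * y powr (1 - a) = (v powr (a - 1) * x) powr a * (v powr a * y) powr (1 - a)"
    using assms by (simp add: powr_mult powr_powr)
  also have "\<dots> \<le> a * (v powr (a - 1) * x) + (1 - a) * (v powr a * y)"
    using assms by (intro weighted_young) auto
  finally show ?thesis by (simp add: algebra_simps)
qed

lemma renyi_integrand_gt:
  assumes "1 < a" "0 \<le> x" "0 < y"
  shows "renyi_integrand a x y = ennreal (x powr a / y powr (a - 1))"
  using assms by (simp add: renyi_integrand_def divide_ennreal)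

lemma renyi_integrand_gt_zero:
  assumes "1 < a" "0 \<le> x"
  shows "renyi_integrand a x 0 = (if x = 0 then 0 else \<infinity>)"
  using assms by (simp add: renyi_integrand_def)

text \<open>Weighted AM-GM with weight \<open>1/a\<close> for
  \<open>x powr a / y powr (a - 1)\<close> and \<open>v powr a * y\<close>, where the powers of
  \<open>y\<close> cancel. The form without subtraction in \<open>ennreal\<close> also covers
  \<open>y = 0\<close>, where the integrand may be infinite.\<close>

lemma powr_tangent_gt:
  fixes a v x y :: real
  assumes "1 < a" "0 \<le> v" "0 \<le> x" "0 \<le> y"
  shows "ennreal (a * v powr (a - 1) * x) \<le> ennreal ((a - 1) * v powr a * y) + renyi_integrand a x y"
proof (cases "y = 0")
  case True
  then show ?thesis using assms by (simp add: renyi_integrand_gt_zero)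
next
  case False
  then have y: "0 < y" using assms by simp
  have e: "a * (1 - 1/a) = a - 1" using assms by (simp add: field_simps)
  define z where "z = y powr (1 - 1/a)"
  have z: "0 < z" using y by (simp add: z_def)
  have "y powr ((a - 1) * (1/a)) = z" using assms by (simp add: z_def field_simps)
  then have "v powr (a - 1) * x = (x powr a / y powr (a - 1)) powr (1/a) * (v powr a * y) powr (1 - 1/a)"
    using assms y z by (simp add: powr_mult powr_divide powr_powr e z_def[symmetric] del: powr_mult_base)
  also have "\<dots> \<le> (1/a) * (x powr a / y powr (a - 1)) + (1 - 1/a) * (v powr a * y)"
    using assms by (intro weighted_young) auto
  finally have "a * (v powr (a - 1) * x) \<le> a * ((1/a) * (x powr a / y powr (a - 1)) + (1 - 1/a) * (v powr a * y))"
    using assms by (intro mult_left_mono) auto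
  also have "\<dots> = (a - 1) * v powr a * y + x powr a / y powr (a - 1)"
    using assms by (simp add: field_simps)
  finally have "ennreal (a * v powr (a - 1) * x) \<le> ennreal ((a - 1) * v powr a * y + x powr a / y powr (a - 1))"
    by (intro ennreal_leI) (simp add: mult.assoc)
  then show ?thesis
    using assms y by (simp add: renyi_integrand_gt)
qed

text \<open>Since \<open>a = s * b + (1 - s)\<close>, the integrand of order \<open>a\<close> is a
  geometric mean of the one of order \<open>b\<close> and of \<open>x\<close>, the integrand of
  order 1. The exponential weights are such that the bound \<open>exp ((b - 1) * c)\<close> on the
  integral of order \<open>b\<close> turns into \<open>exp ((a - 1) * c)\<close> for order
  \<open>a\<close>.\<close>

lemma powr_interpolate_gt:
  fixes a b c x y :: real
  assumes "1 < a" "a < b" "0 \<le> x" "0 \<le> y"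
  defines "s \<equiv> (a - 1) / (b - 1)"
  shows "renyi_integrand a x y \<le> ennreal (s * exp ((a - 1) * c - (b - 1) * c)) * renyi_integrand b x y
           + ennreal ((1 - s) * exp ((a - 1) * c) * x)"
proof (cases "y = 0")
  case True
  have "0 < s" using assms by (simp add: s_def)
  then show ?thesis using assms True by (simp add: renyi_integrand_gt_zero ennreal_mult_top)
next
  case False
  then have y: "0 < y" using assms by simp
  have s: "0 < s" "s < 1" "(b - 1) * s = a - 1" using assms by (auto simp: s_def)
  then have bs: "b * s + (1 - s) = a" by (simp add: algebra_simps)
  define X where "X = exp (- ((b - 1) * c)) * (x powr b / y powr (b - 1))"
  have "exp (- ((b - 1) * c)) powr s = exp (- ((a - 1) * c))"
    by (simp add: powr_def s(3)[symmetric])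
  moreover have "x powr (b * s) * x powr (1 - s) = x powr a"
    using assms(3) bs by (cases "x = 0") (simp_all add: powr_add[symmetric])
  ultimately have "exp (- ((a - 1) * c)) * (x powr a / y powr (a - 1)) = X powr s * x powr (1 - s)"
    using assms y s by (simp add: X_def powr_mult powr_divide powr_powr mult.assoc)
  also have "\<dots> \<le> s * X + (1 - s) * x"
    using assms s y by (intro weighted_young) (auto simp: X_def)
  finally have "exp ((a - 1) * c) * (exp (- ((a - 1) * c)) * (x powr a / y powr (a - 1))) \<le> exp ((a - 1) * c) * (s * X + (1 - s) * x)"
    by (intro mult_left_mono) auto
  then have "x powr a / y powr (a - 1) \<le> s * exp ((a - 1) * c - (b - 1) * c) * (x powr b / y powr (b - 1)) + (1 - s) * exp ((a - 1) * c) * x"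
    by (simp add: X_def exp_diff exp_minus field_simps)
  then show ?thesis
    using assms y s
    by (simp add: renyi_integrand_gt ennreal_plus[symmetric] ennreal_mult[symmetric] ennreal_leI del: ennreal_plus)
qed

text \<open>Here the larger order \<open>b = s * a + (1 - s)\<close> is the one between
  \<open>a\<close> and 1.\<close>

lemma powr_interpolate_lt:
  fixes a b c x y :: real
  assumes "0 < a" "a < b" "b < 1" "0 \<le> x" "0 \<le> y"
  defines "s \<equiv> (1 - b) / (1 - a)"
  shows "exp ((1 - b) * c) * (x powr b * y powr (1 - b)) \<le>
     s * exp ((1 - a) * c) * (x powr a * y powr (1 - a)) + (1 - s) * x"
proof -
  have s: "0 < s" "s < 1" "(1 - a) * s = 1 - b" using assms by (auto simp: s_def)
  then have as: "a * s + (1 - s) = b" by (simp add: algebra_simps)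
  define X where "X = exp ((1 - a) * c) * (x powr a * y powr (1 - a))"
  have "exp ((1 - a) * c) powr s = exp ((1 - b) * c)"
    by (simp add: powr_def s(3)[symmetric])
  moreover have "x powr (a * s) * x powr (1 - s) = x powr b"
    using assms(4) as by (cases "x = 0") (simp_all add: powr_add[symmetric])
  ultimately have "exp ((1 - b) * c) * (x powr b * y powr (1 - b)) = X powr s * x powr (1 - s)"
    using assms s by (simp add: X_def powr_mult powr_powr mult.assoc mult.left_commute)
  also have "\<dots> \<le> s * X + (1 - s) * x"
    using assms s by (intro weighted_young) (auto simp: X_def)
  finally show ?thesis by (simp add: X_def algebra_simps)
qed

section \<open>Removing the logarithm and the limits in the order\<close>

lemma ln_ennreal_le_iff_gt:
  assumes "1 < a"
  shows "ereal (1 / (a - 1)) * ln_ennreal x \<le> ereal c \<longleftrightarrow> x \<le> ennreal (exp ((a - 1) * c))"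
proof (cases x)
  case (real r)
  show ?thesis
  proof (cases "r = 0")
    case False
    then have "0 < r" using real by simp
    have "ln r / (a - 1) \<le> c \<longleftrightarrow> ln r \<le> (a - 1) * c" using assms by (simp add: field_simps)
    also have "\<dots> \<longleftrightarrow> r \<le> exp ((a - 1) * c)"
      using \<open>0 < r\<close> by (metis exp_le_cancel_iff exp_ln)
    finally show ?thesis using \<open>0 < r\<close> real by (simp add: ln_ennreal_def)
  qed (use real assms in \<open>simp add: ln_ennreal_def\<close>)
qed (use assms in \<open>simp add: ln_ennreal_def top_unique\<close>)

text \<open>The factor \<open>1 / (a - 1)\<close> is negative and reverses the inequality; a
  vanishing integral means infinite divergence.\<close>

lemma ln_ennreal_le_iff_lt:
  assumes "a < 1"
  shows "ereal (1 / (a - 1)) * ln_ennreal x \<le> ereal c \<longleftrightarrow> ennreal (exp ((a - 1) * c)) \<le> x"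
proof (cases x)
  case (real r)
  show ?thesis
  proof (cases "r = 0")
    case False
    then have "0 < r" using real by simp
    have "ln r / (a - 1) \<le> c \<longleftrightarrow> (a - 1) * c \<le> ln r" using assms by (simp add: field_simps)
    also have "\<dots> \<longleftrightarrow> exp ((a - 1) * c) \<le> r"
      using \<open>0 < r\<close> by (metis exp_le_cancel_iff exp_ln)
    finally show ?thesis using \<open>0 < r\<close> real by (simp add: ln_ennreal_def)
  qed (use real assms in \<open>simp add: ln_ennreal_def\<close>)
qed (use assms in \<open>simp add: ln_ennreal_def\<close>)

lemma tendsto_mono_SUP:
  fixes f :: "real \<Rightarrow> ereal"
  assumes mono: "\<And>a b. a \<in> A \<Longrightarrow> b \<in> A \<Longrightarrow> a \<le> b \<Longrightarrow> f a \<le> f b"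
    and A: "eventually (\<lambda>a. a \<in> A) F" and F: "\<And>a. a \<in> A \<Longrightarrow> eventually (\<lambda>b. a \<le> b) F"
  shows "(f \<longlongrightarrow> (SUP a\<in>A. f a)) F"
proof (rule increasing_tendsto)
  show "eventually (\<lambda>a. f a \<le> (SUP a\<in>A. f a)) F"
    using A by eventually_elim (rule SUP_upper)
  fix l assume "l < (SUP a\<in>A. f a)"
  then obtain a where a: "a \<in> A" "l < f a" by (auto simp: less_SUP_iff)
  show "eventually (\<lambda>b. l < f b) F"
    using A F[OF a(1)] by eventually_elim (use a mono less_le_trans in blast)
qed

text \<open>\<open>Lim\<close> is a definite description, so convergence comes first: a monotone
  function tends to its supremum.\<close>

lemma Lim_mono_le_iff:
  fixes f :: "real \<Rightarrow> ereal"
  assumes "\<And>a b. a \<in> A \<Longrightarrow> b \<in> A \<Longrightarrow> a \<le> b \<Longrightarrow> f a \<le> f b"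
    and "eventually (\<lambda>a. a \<in> A) F" and "\<And>a. a \<in> A \<Longrightarrow> eventually (\<lambda>b. a \<le> b) F" and "F \<noteq> bot"
  shows "Lim F f \<le> c \<longleftrightarrow> (\<forall>a\<in>A. f a \<le> c)"
  using tendsto_Lim[OF assms(4) tendsto_mono_SUP[OF assms(1-3)]] by (simp add: SUP_le_iff)

section \<open>Integrated inequalities for a pair of densities\<close>

locale density_pair =
  fixes \<mu> P Q :: "'a::topological_space measure" and p q :: "'a \<Rightarrow> real"
  assumes sets_\<mu> [simp, measurable_cong]: "sets \<mu> = sets borel"
    and p [measurable]: "p \<in> borel_measurable borel" and p0: "\<And>x. 0 \<le> p x"
    and q [measurable]: "q \<in> borel_measurable borel" and q0: "\<And>x. 0 \<le> q x"
    and P: "P = density \<mu> p" "P \<in> space (prob_algebra borel)"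
    and Q: "Q = density \<mu> q" "Q \<in> space (prob_algebra borel)"
begin

abbreviation "I a \<equiv> \<integral>\<^sup>+x. renyi_integrand a (p x) (q x) \<partial>\<mu>"

lemma nn_integral_p:
  assumes g: "bounded_measurable g" "\<And>x. 0 \<le> g x"
  shows "(\<integral>\<^sup>+x. ennreal (g x * p x) \<partial>\<mu>) = ennreal (integral\<^sup>L P g)"
proof -
  have [measurable]: "g \<in> borel_measurable borel" using g(1) by (rule bounded_measurable_measurable)
  have "ennreal (integral\<^sup>L P g) = (\<integral>\<^sup>+x. ennreal (g x) \<partial>P)"
    using nn_integral_eq_integral[OF bounded_measurable_integrable[OF P(2) g(1)]] g(2) by simp
  also have "\<dots> = (\<integral>\<^sup>+x. ennreal (g x * p x) \<partial>\<mu>)"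
    unfolding P(1) using g p0 by (subst nn_integral_density) (auto simp: ennreal_mult mult.commute)
  finally show ?thesis by simp
qed

lemma nn_integral_q:
  assumes g: "bounded_measurable g" "\<And>x. 0 \<le> g x"
  shows "(\<integral>\<^sup>+x. ennreal (g x * q x) \<partial>\<mu>) = ennreal (integral\<^sup>L Q g)"
proof -
  \<comment> \<open>The assumptions are symmetric, so the roles of \<open>P\<close> and
    \<open>Q\<close> can be exchanged.\<close>
  interpret d: density_pair \<mu> Q P q p using p q p0 q0 P Q by unfold_locales auto
  show ?thesis using d.nn_integral_p[OF g] .
qed


lemma nn_integral_p1: "(\<integral>\<^sup>+x. ennreal (p x) \<partial>\<mu>) = 1"
proof -
  interpret P: prob_space P using P by (simp add: space_prob_algebra)
  show ?thesis using nn_integral_p[OF bounded_measurable_const[of 1]] P.prob_space by simp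
qed

lemma I_gtD:
  assumes a: "1 < a" and I: "I a \<le> ennreal (exp ((a - 1) * c))"
    and g: "bounded_measurable g" "\<And>x. 0 \<le> g x"
  shows "(\<integral>x. a * g x powr (a - 1) \<partial>P) \<le> exp ((a - 1) * c) + (a - 1) * (\<integral>x. g x powr a \<partial>Q)"
proof -
  have [measurable]: "g \<in> borel_measurable borel" using g(1) by (rule bounded_measurable_measurable)
  have b: "bounded_measurable (\<lambda>x. g x powr (a - 1))" "bounded_measurable (\<lambda>x. g x powr a)"
    using g a by (auto intro!: bounded_measurable_powr[where e = 0])
  have "ennreal (\<integral>x. a * g x powr (a - 1) \<partial>P) = (\<integral>\<^sup>+x. ennreal (a * g x powr (a - 1) * p x) \<partial>\<mu>)"
    using a by (intro nn_integral_p[symmetric] bounded_measurable_cmult b) auto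
  also have "\<dots> \<le> (\<integral>\<^sup>+x. ennreal ((a - 1) * g x powr a * q x) + renyi_integrand a (p x) (q x) \<partial>\<mu>)"
    using a g p0 q0 by (intro nn_integral_mono powr_tangent_gt) auto
  also have "\<dots> = (\<integral>\<^sup>+x. ennreal ((a - 1) * g x powr a * q x) \<partial>\<mu>) + I a"
    by (rule nn_integral_add) auto
  also have "(\<integral>\<^sup>+x. ennreal ((a - 1) * g x powr a * q x) \<partial>\<mu>) = ennreal (\<integral>x. (a - 1) * g x powr a \<partial>Q)"
    using a by (intro nn_integral_q bounded_measurable_cmult b) auto
  also have "\<dots> + I a \<le> ennreal (\<integral>x. (a - 1) * g x powr a \<partial>Q) + ennreal (exp ((a - 1) * c))"
    using I by (rule add_left_mono)
  also have "\<dots> = ennreal ((\<integral>x. (a - 1) * g x powr a \<partial>Q) + exp ((a - 1) * c))"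
    using a by (subst ennreal_plus) (auto intro!: integral_nonneg_AE)
  finally have "(\<integral>x. a * g x powr (a - 1) \<partial>P) \<le> (\<integral>x. (a - 1) * g x powr a \<partial>Q) + exp ((a - 1) * c)"
    using a by (subst (asm) ennreal_le_iff) (auto intro!: add_nonneg_nonneg integral_nonneg_AE)
  then show ?thesis by simp
qed

text \<open>The tangent at the truncated ratio \<open>g n\<close> is nearly sharp. As
  \<open>g n * q \<le> p\<close>, the \<open>Q\<close>-term is at most \<open>a - 1\<close> times
  the integral of \<open>g n powr (a - 1)\<close> under \<open>P\<close>; it is absorbed on the
  left, leaving factor 1, and monotone convergence gives \<open>I a\<close>.\<close>

lemma I_gtI:
  assumes a: "1 < a"
    and H: "\<And>g. bounded_measurable g \<Longrightarrow> (\<And>x. 0 \<le> g x) \<Longrightarrow>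
      (\<integral>x. a * g x powr (a - 1) \<partial>P) \<le> exp ((a - 1) * c) + (a - 1) * (\<integral>x. g x powr a \<partial>Q)"
  shows "I a \<le> ennreal (exp ((a - 1) * c))"
proof -
  \<comment> \<open>On \<open>q = 0 < p\<close> the value \<open>n\<close> grows without bound,
    matching the convention \<open>x / 0 = \<infinity>\<close>.\<close>
  define g where "g n x = (if q x = 0 then if p x = 0 then 0 else real n else min (real n) (p x / q x))" for n x
  have g0: "0 \<le> g n x" for n x using p0 q0 by (simp add: g_def)
  have [measurable]: "g n \<in> borel_measurable borel" for n unfolding g_def by measurable
  have "\<bar>g n x\<bar> \<le> real n" for n x using g0[of n x] by (simp add: g_def)
  then have bg: "bounded_measurable (g n)" for n
    by (auto simp: bounded_measurable_def bounded_iff)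
  have b: "bounded_measurable (\<lambda>x. g n x powr (a - 1))" "bounded_measurable (\<lambda>x. g n x powr a)" for n
    using bg g0 a by (auto intro!: bounded_measurable_powr[where e = 0])
  have gq: "g n x * q x \<le> p x" for n x
  proof (cases "q x = 0")
    case False
    then have "0 < q x" using q0[of x] by simp
    have "g n x * q x \<le> p x / q x * q x"
      using False \<open>0 < q x\<close> by (intro mult_right_mono) (auto simp: g_def)
    then show ?thesis using False by simp
  qed (simp add: p0)
  have bound: "(\<integral>\<^sup>+x. ennreal (g n x powr (a - 1) * p x) \<partial>\<mu>) \<le> ennreal (exp ((a - 1) * c))" for n
  proof -
    have "ennreal (\<integral>x. g n x powr a \<partial>Q) = (\<integral>\<^sup>+x. ennreal (g n x powr a * q x) \<partial>\<mu>)"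
      by (intro nn_integral_q[symmetric] b) auto
    also have "\<dots> \<le> (\<integral>\<^sup>+x. ennreal (g n x powr (a - 1) * p x) \<partial>\<mu>)"
    proof (intro nn_integral_mono ennreal_leI)
      fix x
      have "g n x powr a = g n x powr (a - 1) * g n x"
        using g0[of n x] by (cases "g n x = 0") (simp_all add: powr_diff)
      then show "g n x powr a * q x \<le> g n x powr (a - 1) * p x"
        using gq[of n x] by (simp add: mult.assoc mult_left_mono)
    qed
    also have "\<dots> = ennreal (\<integral>x. g n x powr (a - 1) \<partial>P)"
      by (intro nn_integral_p b) auto
    finally have "(\<integral>x. g n x powr a \<partial>Q) \<le> (\<integral>x. g n x powr (a - 1) \<partial>P)"
      by (subst (asm) ennreal_le_iff) (auto intro!: integral_nonneg_AE)
    then have "(a - 1) * (\<integral>x. g n x powr a \<partial>Q) \<le> (a - 1) * (\<integral>x. g n x powr (a - 1) \<partial>P)"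
      using a by (intro mult_left_mono) auto
    with H[OF bg g0, of n] have "(\<integral>x. g n x powr (a - 1) \<partial>P) \<le> exp ((a - 1) * c)"
      by (simp add: algebra_simps)
    moreover have "(\<integral>\<^sup>+x. ennreal (g n x powr (a - 1) * p x) \<partial>\<mu>) = ennreal (\<integral>x. g n x powr (a - 1) \<partial>P)"
      by (intro nn_integral_p b) auto
    ultimately show ?thesis by (simp add: ennreal_leI)
  qed
  have "incseq (\<lambda>n x. ennreal (g n x powr (a - 1) * p x))"
    using a p0 q0 by (auto simp: incseq_def le_fun_def g_def intro!: ennreal_leI mult_right_mono powr_mono2)
  then have SUP: "(\<integral>\<^sup>+x. (SUP n. ennreal (g n x powr (a - 1) * p x)) \<partial>\<mu>) = (SUP n. \<integral>\<^sup>+x. ennreal (g n x powr (a - 1) * p x) \<partial>\<mu>)"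
    by (rule nn_integral_monotone_convergence_SUP) auto
  have "renyi_integrand a (p x) (q x) \<le> (SUP n. ennreal (g n x powr (a - 1) * p x))" for x
  proof (cases "q x = 0")
    case False
    then have q': "0 < q x" using q0[of x] by simp
    obtain n where "p x / q x \<le> real n" using real_arch_simple by blast
    then have "g n x = p x / q x" using False by (simp add: g_def)
    moreover have "(p x / q x) powr (a - 1) * p x = p x powr a / q x powr (a - 1)"
      using p0[of x] q' by (cases "p x = 0") (simp_all add: powr_divide powr_diff)
    ultimately have "renyi_integrand a (p x) (q x) = ennreal (g n x powr (a - 1) * p x)"
      using a p0 q' by (simp add: renyi_integrand_gt)
    then show ?thesis by (simp only:) (rule SUP_upper, simp)
  next
    case q': True
    show ?thesis
    proof (cases "p x = 0")
      case False
      then have p': "0 < p x" using p0[of x] by simp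
      have "(SUP n. ennreal (g n x powr (a - 1) * p x)) = \<top>"
      proof (rule ennreal_SUP_eq_top)
        fix k :: nat
        have "filterlim (\<lambda>n. real n powr (a - 1) * p x) at_top sequentially"
          using a p' by real_asymp
        then have "eventually (\<lambda>n. real k \<le> real n powr (a - 1) * p x) sequentially"
          by (simp add: filterlim_at_top)
        then obtain n where "real k \<le> real n powr (a - 1) * p x" by (auto simp: eventually_sequentially)
        then have "of_nat k \<le> ennreal (g n x powr (a - 1) * p x)"
          using q' False by (simp add: g_def ennreal_of_nat_eq_real_of_nat ennreal_leI)
        then show "\<exists>n\<in>UNIV. of_nat k \<le> ennreal (g n x powr (a - 1) * p x)" by blast
      qed
      then show ?thesis by (simp only: top_greatest)
    qed (use a q' in \<open>simp add: renyi_integrand_gt_zero\<close>)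
  qed
  then have "I a \<le> (SUP n. \<integral>\<^sup>+x. ennreal (g n x powr (a - 1) * p x) \<partial>\<mu>)"
    unfolding SUP[symmetric] by (rule nn_integral_mono)
  also have "\<dots> \<le> ennreal (exp ((a - 1) * c))" by (rule SUP_least) (rule bound)
  finally show ?thesis .
qed

lemma I_lt_le:
  assumes a: "0 < a" "a < 1" and e: "0 < e" and g: "bounded_measurable g" "\<And>x. e \<le> g x"
  shows "I a \<le> ennreal ((\<integral>x. a * g x powr (a - 1) \<partial>P) + (1 - a) * (\<integral>x. g x powr a \<partial>Q))"
proof -
  have [measurable]: "g \<in> borel_measurable borel" using g(1) by (rule bounded_measurable_measurable)
  have b: "bounded_measurable (\<lambda>x. g x powr (a - 1))" "bounded_measurable (\<lambda>x. g x powr a)"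
    using g a e by (auto intro!: bounded_measurable_powr[where e = e])
  have "I a \<le> (\<integral>\<^sup>+x. ennreal (a * g x powr (a - 1) * p x) + ennreal ((1 - a) * g x powr a * q x) \<partial>\<mu>)"
  proof (rule nn_integral_mono)
    fix x
    have "p x powr a * q x powr (1 - a) \<le> a * g x powr (a - 1) * p x + (1 - a) * g x powr a * q x"
      using a e g(2)[of x] p0 q0 by (intro powr_tangent_lt) auto
    then show "renyi_integrand a (p x) (q x) \<le> ennreal (a * g x powr (a - 1) * p x) + ennreal ((1 - a) * g x powr a * q x)"
      using a p0 q0 by (simp add: renyi_integrand_def ennreal_plus[symmetric] ennreal_leI del: ennreal_plus)
  qed
  also have "\<dots> = (\<integral>\<^sup>+x. ennreal (a * g x powr (a - 1) * p x) \<partial>\<mu>) + (\<integral>\<^sup>+x. ennreal ((1 - a) * g x powr a * q x) \<partial>\<mu>)"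
    by (rule nn_integral_add) auto
  also have "(\<integral>\<^sup>+x. ennreal (a * g x powr (a - 1) * p x) \<partial>\<mu>) = ennreal (\<integral>x. a * g x powr (a - 1) \<partial>P)"
    using a by (intro nn_integral_p bounded_measurable_cmult b) auto
  also have "(\<integral>\<^sup>+x. ennreal ((1 - a) * g x powr a * q x) \<partial>\<mu>) = ennreal (\<integral>x. (1 - a) * g x powr a \<partial>Q)"
    using a by (intro nn_integral_q bounded_measurable_cmult b) auto
  also have "ennreal (\<integral>x. a * g x powr (a - 1) \<partial>P) + ennreal (\<integral>x. (1 - a) * g x powr a \<partial>Q)
     = ennreal ((\<integral>x. a * g x powr (a - 1) \<partial>P) + (\<integral>x. (1 - a) * g x powr a \<partial>Q))"
    using a by (subst ennreal_plus) (auto intro!: integral_nonneg_AE)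
  finally show ?thesis by simp
qed

text \<open>The negative exponent \<open>a - 1\<close> forces truncation of \<open>p / q\<close>
  from below as well. Instead of monotone convergence there is an explicit error, with integral
  \<open>n powr (a - 1) + n powr (- a)\<close>, which tends to 0.\<close>

lemma I_ltI:
  assumes a: "0 < a" "a < 1"
    and H: "\<And>g e. bounded_measurable g \<Longrightarrow> 0 < e \<Longrightarrow> (\<And>x. e \<le> g x) \<Longrightarrow>
      K \<le> (\<integral>x. a * g x powr (a - 1) \<partial>P) + (1 - a) * (\<integral>x. g x powr a \<partial>Q)"
  shows "ennreal K \<le> I a"
proof -
  have bound: "ennreal K \<le> I a + ennreal (real n powr (a - 1) + real n powr (- a))" if n: "1 \<le> n" for n
  proof -
    have n0: "0 < real n" and n1: "1 \<le> real n" "1 / real n \<le> real n"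
      using n mult_mono[of 1 "real n" 1 "real n"] by (auto simp: field_simps)
    define g where "g x = (if q x = 0 then real n else max (1 / real n) (min (real n) (p x / q x)))" for x
    have [measurable]: "g \<in> borel_measurable borel" unfolding g_def by measurable
    have ge: "1 / real n \<le> g x" and gn: "g x \<le> real n" for x using n1 by (auto simp: g_def)
    then have g0: "0 < g x" for x using n0 by (meson less_le_trans zero_less_divide_1_iff)
    have bg: "bounded_measurable g"
      using g0 gn by (auto simp: bounded_measurable_def bounded_iff abs_of_pos intro!: exI[of _ "real n"])
    have b: "bounded_measurable (\<lambda>x. g x powr (a - 1))" "bounded_measurable (\<lambda>x. g x powr a)"
      using bg ge n0 by (auto intro!: bounded_measurable_powr[where e = "1 / real n"])
    \<comment> \<open>Between \<open>1/n\<close> and \<open>n\<close> the tangent is exact. Above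
      \<open>n\<close>, or where \<open>q = 0\<close>, \<open>g * q \<le> p\<close> bounds
      everything by the \<open>p\<close>-error; below \<open>1/n\<close>,
      \<open>p \<le> g * q\<close> gives the \<open>q\<close>-error.\<close>
    have pw: "a * g x powr (a - 1) * p x + (1 - a) * g x powr a * q x \<le>
        p x powr a * q x powr (1 - a) + (real n powr (a - 1) * p x + real n powr (- a) * q x)" for x
    proof -
      have ga: "g x powr a = g x powr (a - 1) * g x" using g0[of x] by (simp add: powr_diff)
      consider "q x = 0" | "0 < q x" "real n < p x / q x" | "0 < q x" "p x / q x < 1 / real n"
        | "0 < q x" "1 / real n \<le> p x / q x" "p x / q x \<le> real n"
        using q0[of x] by force
      then show ?thesis
      proof cases
        case 1
        have "a * (real n powr (a - 1) * p x) \<le> 1 * (real n powr (a - 1) * p x)"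
          using a p0 by (intro mult_right_mono) auto
        then show ?thesis using 1 by (simp add: g_def mult.assoc)
      next
        case 2
        then have g: "g x = real n" using n1 by (simp add: g_def)
        have "(1 - a) * (real n powr (a - 1) * (real n * q x)) \<le> (1 - a) * (real n powr (a - 1) * p x)"
          using 2 a by (intro mult_left_mono) (auto simp: field_simps)
        then have "a * g x powr (a - 1) * p x + (1 - a) * g x powr a * q x \<le> real n powr (a - 1) * p x"
          unfolding ga by (simp add: g algebra_simps)
        also have "\<dots> \<le> p x powr a * q x powr (1 - a) + (real n powr (a - 1) * p x + real n powr (- a) * q x)"
          using p0 q0 by (simp add: add_increasing add_increasing2)
        finally show ?thesis .
      next
        case 3
        then have g: "g x = 1 / real n" using n1 by (simp add: g_def)
        have "p x \<le> g x * q x" using 3 n0 by (simp add: g field_simps)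
        then have "a * (g x powr (a - 1) * p x) \<le> a * (g x powr (a - 1) * (g x * q x))"
          using a by (intro mult_left_mono) auto
        then have "a * g x powr (a - 1) * p x + (1 - a) * g x powr a * q x \<le> g x powr a * q x"
          unfolding ga by (simp add: algebra_simps)
        also have "g x powr a * q x = real n powr (- a) * q x" using n0 by (simp add: g powr_divide powr_minus_divide)
        also have "real n powr (- a) * q x \<le> p x powr a * q x powr (1 - a) + (real n powr (a - 1) * p x + real n powr (- a) * q x)"
          using p0 q0 by (simp add: add_increasing add_increasing2)
        finally show ?thesis .
      next
        case 4
        then have g: "g x = p x / q x" by (simp add: g_def)
        then have px: "p x = g x * q x" using 4 by simp
        have "p x powr a * q x powr (1 - a) = g x powr a * (q x powr a * q x powr (1 - a))"
          using 4 g0[of x] by (simp add: px powr_mult)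
        also have "q x powr a * q x powr (1 - a) = q x" using 4 by (simp add: powr_add[symmetric])
        finally have "p x powr a * q x powr (1 - a) = g x powr a * q x" .
        moreover have "a * g x powr (a - 1) * p x = a * g x powr a * q x" unfolding ga by (subst px) simp
        ultimately have "a * g x powr (a - 1) * p x + (1 - a) * g x powr a * q x = p x powr a * q x powr (1 - a)"
          by (simp add: algebra_simps)
        then show ?thesis using p0 q0 by simp
      qed
    qed
    have "ennreal K \<le> ennreal ((\<integral>x. a * g x powr (a - 1) \<partial>P) + (\<integral>x. (1 - a) * g x powr a \<partial>Q))"
      using H[OF bg _ ge] n0 by (intro ennreal_leI) simp
    also have "\<dots> = ennreal (\<integral>x. a * g x powr (a - 1) \<partial>P) + ennreal (\<integral>x. (1 - a) * g x powr a \<partial>Q)"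
      using a by (subst ennreal_plus) (auto intro!: integral_nonneg_AE)
    also have "ennreal (\<integral>x. a * g x powr (a - 1) \<partial>P) = (\<integral>\<^sup>+x. ennreal (a * g x powr (a - 1) * p x) \<partial>\<mu>)"
      using a by (intro nn_integral_p[symmetric] bounded_measurable_cmult b) auto
    also have "ennreal (\<integral>x. (1 - a) * g x powr a \<partial>Q) = (\<integral>\<^sup>+x. ennreal ((1 - a) * g x powr a * q x) \<partial>\<mu>)"
      using a by (intro nn_integral_q[symmetric] bounded_measurable_cmult b) auto
    also have "(\<integral>\<^sup>+x. ennreal (a * g x powr (a - 1) * p x) \<partial>\<mu>) + (\<integral>\<^sup>+x. ennreal ((1 - a) * g x powr a * q x) \<partial>\<mu>)
        = (\<integral>\<^sup>+x. ennreal (a * g x powr (a - 1) * p x) + ennreal ((1 - a) * g x powr a * q x) \<partial>\<mu>)"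
      by (rule nn_integral_add[symmetric]) auto
    also have "\<dots> \<le> (\<integral>\<^sup>+x. renyi_integrand a (p x) (q x) + (ennreal (real n powr (a - 1) * p x) + ennreal (real n powr (- a) * q x)) \<partial>\<mu>)"
      using pw a p0 q0
      by (intro nn_integral_mono) (simp add: renyi_integrand_def ennreal_plus[symmetric] ennreal_leI del: ennreal_plus)
    also have "\<dots> = I a + ((\<integral>\<^sup>+x. ennreal (real n powr (a - 1) * p x) \<partial>\<mu>) + (\<integral>\<^sup>+x. ennreal (real n powr (- a) * q x) \<partial>\<mu>))"
      by (subst nn_integral_add, simp, simp, subst nn_integral_add) auto
    also have "(\<integral>\<^sup>+x. ennreal (real n powr (a - 1) * p x) \<partial>\<mu>) = ennreal (\<integral>x. real n powr (a - 1) \<partial>P)"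
      by (intro nn_integral_p bounded_measurable_const) auto
    also have "(\<integral>\<^sup>+x. ennreal (real n powr (- a) * q x) \<partial>\<mu>) = ennreal (\<integral>x. real n powr (- a) \<partial>Q)"
      by (intro nn_integral_q bounded_measurable_const) auto
    finally show ?thesis
      using P(2) Q(2) by (simp add: space_prob_algebra prob_space.prob_space)
  qed
  have "(\<lambda>n. real n powr (a - 1)) \<longlonglongrightarrow> 0" "(\<lambda>n. real n powr (- a)) \<longlonglongrightarrow> 0"
    using a by real_asymp+
  then have "(\<lambda>n. real n powr (a - 1) + real n powr (- a)) \<longlonglongrightarrow> 0"
    by (rule tendsto_add_zero)
  then have "(\<lambda>n. ennreal (real n powr (a - 1) + real n powr (- a))) \<longlonglongrightarrow> ennreal 0"
    by (rule tendsto_ennrealI)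
  then have "(\<lambda>n. I a + ennreal (real n powr (a - 1) + real n powr (- a))) \<longlonglongrightarrow> I a + ennreal 0"
    by (intro tendsto_add tendsto_const)
  then show ?thesis
    using bound by (intro LIMSEQ_le_const[of _ "I a" "ennreal K"]) auto
qed

lemma I_gt_mono:
  assumes a: "1 < a" "a < b" and I: "I b \<le> ennreal (exp ((b - 1) * c))"
  shows "I a \<le> ennreal (exp ((a - 1) * c))"
proof -
  define s where "s = (a - 1) / (b - 1)"
  have s: "0 < s" "s < 1" using a by (auto simp: s_def)
  have "I a \<le> (\<integral>\<^sup>+x. ennreal (s * exp ((a - 1) * c - (b - 1) * c)) * renyi_integrand b (p x) (q x)
      + ennreal ((1 - s) * exp ((a - 1) * c)) * ennreal (p x) \<partial>\<mu>)"
    using powr_interpolate_gt[OF a, folded s_def] p0 q0 s by (intro nn_integral_mono) (simp add: ennreal_mult)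
  also have "\<dots> = ennreal (s * exp ((a - 1) * c - (b - 1) * c)) * I b + ennreal ((1 - s) * exp ((a - 1) * c))"
    by (subst nn_integral_add) (auto simp: nn_integral_cmult nn_integral_p1)
  also have "\<dots> \<le> ennreal (s * exp ((a - 1) * c - (b - 1) * c)) * ennreal (exp ((b - 1) * c)) + ennreal ((1 - s) * exp ((a - 1) * c))"
    using I by (intro add_right_mono mult_left_mono) auto
  also have "\<dots> = ennreal (exp ((a - 1) * c))"
    using s by (simp add: ennreal_mult[symmetric] ennreal_plus[symmetric] exp_diff del: ennreal_plus) (simp add: algebra_simps)
  finally show ?thesis .
qed

lemma I_lt_mono:
  assumes a: "0 < a" "a < b" "b < 1" and I: "ennreal (exp ((b - 1) * c)) \<le> I b"
  shows "ennreal (exp ((a - 1) * c)) \<le> I a"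
proof -
  define s where "s = (1 - b) / (1 - a)"
  have s: "0 < s" "s < 1" using a by (auto simp: s_def)
  \<comment> \<open>The number 1 is split so that \<open>1 - s\<close> cancels against the integral
    of \<open>(1 - s) * p\<close> at the end.\<close>
  have "ennreal (s * 1 + (1 - s)) = ennreal (exp ((1 - b) * c)) * ennreal (exp ((b - 1) * c))"
    by (simp add: ennreal_mult[symmetric] exp_add[symmetric] algebra_simps)
  also have "\<dots> \<le> ennreal (exp ((1 - b) * c)) * I b"
    using I by (intro mult_left_mono) auto
  also have "\<dots> = (\<integral>\<^sup>+x. ennreal (exp ((1 - b) * c)) * renyi_integrand b (p x) (q x) \<partial>\<mu>)"
    by (simp add: nn_integral_cmult)
  also have "\<dots> \<le> (\<integral>\<^sup>+x. ennreal (s * exp ((1 - a) * c)) * renyi_integrand a (p x) (q x) + ennreal (1 - s) * ennreal (p x) \<partial>\<mu>)"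
    using powr_interpolate_lt[OF a, folded s_def] p0 q0 s a
    by (intro nn_integral_mono)
      (simp add: renyi_integrand_def ennreal_mult[symmetric] ennreal_plus[symmetric] ennreal_leI del: ennreal_plus)
  also have "\<dots> = ennreal (s * exp ((1 - a) * c)) * I a + ennreal (1 - s)"
    by (subst nn_integral_add) (auto simp: nn_integral_cmult nn_integral_p1)
  finally have le: "ennreal (s * 1 + (1 - s)) \<le> ennreal (s * exp ((1 - a) * c)) * I a + ennreal (1 - s)" .
  show ?thesis
  proof (cases "I a")
    case (real r)
    with le s have "s * 1 + (1 - s) \<le> s * exp ((1 - a) * c) * r + (1 - s)"
      by (simp add: ennreal_mult[symmetric] ennreal_plus[symmetric] del: ennreal_plus)
    then have "s * 1 \<le> s * (exp ((1 - a) * c) * r)" by (simp add: algebra_simps)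
    then have "1 \<le> exp ((1 - a) * c) * r" using s by (simp only: mult_le_cancel_left_pos)
    then have "exp ((a - 1) * c) * 1 \<le> exp ((a - 1) * c) * (exp ((1 - a) * c) * r)"
      by (intro mult_left_mono) auto
    also have "\<dots> = r" by (simp add: mult.assoc[symmetric] exp_add[symmetric]) (simp add: algebra_simps)
    finally show ?thesis using real by (simp add: ennreal_leI)
  qed simp
qed

end

subsection \<open>Sublevel sets as intersections of halfspaces\<close>

text \<open>The tangent of \<open>x \<mapsto> x powr a\<close> at \<open>v\<close>, multiplied by \<open>q\<close> at \<open>x = p / q\<close>, bounds
  \<open>p powr a * q powr (1 - a)\<close> by \<open>a * v powr (a - 1) * p + (1 - a) * v powr a * q\<close>, from above for
  \<open>a < 1\<close> and from below for \<open>a > 1\<close>. Letting \<open>v = g x\<close> vary with the point makes the bound on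
  the integral of the left-hand side sharp, and linear in \<open>P\<close> for each fixed \<open>g\<close>.\<close>

definition renyi_halfspaces ::
    "'a::topological_space measure \<Rightarrow> real \<Rightarrow> real \<Rightarrow> (('a \<Rightarrow> real) \<times> real) set" where
  "renyi_halfspaces Q c a =
    (if a < 1 then
       {(\<lambda>x. - a * g x powr (a - 1), (1 - a) * (\<integral>x. g x powr a \<partial>Q) - exp ((a - 1) * c)) | g.
          bounded_measurable g \<and> (\<exists>e>0. \<forall>x. e \<le> g x)}
     else
       {(\<lambda>x. a * g x powr (a - 1), exp ((a - 1) * c) + (a - 1) * (\<integral>x. g x powr a \<partial>Q)) | g.
          bounded_measurable g \<and> (\<forall>x. 0 \<le> g x)})"

lemma renyi_halfspaces_bounded_measurable:
  assumes "(G, r) \<in> renyi_halfspaces Q c a" "a \<noteq> 1"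
  shows "bounded_measurable G"
proof (cases "a < 1")
  case True
  then obtain g e where "G = (\<lambda>x. - a * g x powr (a - 1))" "bounded_measurable g" "0 < e" "\<And>x. e \<le> g x"
    using assms by (auto simp: renyi_halfspaces_def)
  then show ?thesis by (simp only:) (intro bounded_measurable_cmult bounded_measurable_powr[of _ e]; simp)
next
  case False
  then obtain g where "G = (\<lambda>x. a * g x powr (a - 1))" "bounded_measurable g" "\<And>x. 0 \<le> g x"
    using assms by (auto simp: renyi_halfspaces_def)
  then show ?thesis using False by (simp only:) (intro bounded_measurable_cmult bounded_measurable_powr[of _ 0]; simp)
qed

text \<open>A null set of the mixture is null for \<open>P\<close> and \<open>Q\<close>, so
  Radon-Nikodym applies; the derivatives are finite almost everywhere, so \<open>enn2real\<close>
  loses nothing.\<close>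

lemma density_pair_mixture:
  assumes P: "P \<in> space (prob_algebra borel)" and Q: "Q \<in> space (prob_algebra borel)"
  defines "\<mu> \<equiv> mixture (1/2) P Q"
  shows "density_pair \<mu> P Q (\<lambda>x. enn2real (RN_deriv \<mu> P x)) (\<lambda>x. enn2real (RN_deriv \<mu> Q x))"
proof -
  have \<mu>: "\<mu> \<in> space (prob_algebra borel)"
    unfolding \<mu>_def by (rule mixture_in_prob_algebra[OF P Q]) auto
  then interpret \<mu>: prob_space \<mu> by (simp add: space_prob_algebra)
  have s\<mu>: "sets \<mu> = sets borel" using \<mu> by (simp add: space_prob_algebra)
  have s: "sets P = sets borel" "sets Q = sets borel" using P Q by (simp_all add: space_prob_algebra)
  have em: "emeasure \<mu> A = ennreal (1/2) * emeasure P A + ennreal (1/2) * emeasure Q A" if "A \<in> sets borel" for A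
    using emeasure_mixture[of Q P A "1/2"] that s by (simp add: \<mu>_def)
  have dens: "R = density \<mu> (\<lambda>x. ennreal (enn2real (RN_deriv \<mu> R x)))"
    if R: "R \<in> space (prob_algebra borel)" and ac: "\<And>A. A \<in> sets borel \<Longrightarrow> emeasure \<mu> A = 0 \<Longrightarrow> emeasure R A = 0" for R
  proof -
    interpret R: prob_space R using R by (simp add: space_prob_algebra)
    have sR: "sets R = sets \<mu>" using R s\<mu> by (simp add: space_prob_algebra)
    have a: "absolutely_continuous \<mu> R"
      unfolding absolutely_continuous_def using ac s\<mu> sR by (auto simp: null_sets_def)
    have "R = density \<mu> (RN_deriv \<mu> R)" using \<mu>.density_RN_deriv[OF a sR] by simp
    also have "\<dots> = density \<mu> (\<lambda>x. ennreal (enn2real (RN_deriv \<mu> R x)))"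
      using \<mu>.RN_deriv_finite[OF R.sigma_finite_measure_axioms a sR]
      by (intro density_cong) (auto simp: less_top)
    finally show ?thesis .
  qed
  have [measurable]: "RN_deriv \<mu> R \<in> borel_measurable borel" for R
    using borel_measurable_RN_deriv[of \<mu> R] s\<mu> by (simp cong: measurable_cong_sets)
  show ?thesis
  proof
    show "P = density \<mu> (\<lambda>x. ennreal (enn2real (RN_deriv \<mu> P x)))"
      by (rule dens[OF P]) (simp add: em)
    show "Q = density \<mu> (\<lambda>x. ennreal (enn2real (RN_deriv \<mu> Q x)))"
      by (rule dens[OF Q]) (simp add: em)
  qed (use P Q s\<mu> in simp_all)
qed

lemma renyi_simple_le_iff_gt:
  assumes P: "P \<in> space (prob_algebra borel)" and Q: "Q \<in> space (prob_algebra borel)" and a: "1 < a"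
  shows "renyi_simple a P Q \<le> ereal c \<longleftrightarrow> (\<forall>(G, r)\<in>renyi_halfspaces Q c a. integral\<^sup>L P G \<le> r)"
proof -
  interpret density_pair "mixture (1/2) P Q" P Q "\<lambda>x. enn2real (RN_deriv (mixture (1/2) P Q) P x)"
      "\<lambda>x. enn2real (RN_deriv (mixture (1/2) P Q) Q x)"
    by (rule density_pair_mixture[OF P Q])
  have "renyi_simple a P Q \<le> ereal c \<longleftrightarrow> I a \<le> ennreal (exp ((a - 1) * c))"
    using ln_ennreal_le_iff_gt[OF a] by (simp add: renyi_simple_def renyi_simple_wrt_def Let_def)
  also have "\<dots> \<longleftrightarrow> (\<forall>g. bounded_measurable g \<and> (\<forall>x. 0 \<le> g x) \<longrightarrow>
      (\<integral>x. a * g x powr (a - 1) \<partial>P) \<le> exp ((a - 1) * c) + (a - 1) * (\<integral>x. g x powr a \<partial>Q))"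
    using I_gtD[OF a, of c] I_gtI[OF a, of c] by blast
  also have "\<dots> \<longleftrightarrow> (\<forall>(G, r)\<in>renyi_halfspaces Q c a. integral\<^sup>L P G \<le> r)"
  proof -
    have "renyi_halfspaces Q c a = (\<lambda>g. (\<lambda>x. a * g x powr (a - 1), exp ((a - 1) * c) + (a - 1) * (\<integral>x. g x powr a \<partial>Q))) `
        {g. bounded_measurable g \<and> (\<forall>x. 0 \<le> g x)}"
      using a unfolding renyi_halfspaces_def by auto
    then show ?thesis by simp
  qed
  finally show ?thesis .
qed

lemma renyi_simple_le_iff_lt:
  fixes P Q :: "'a::topological_space measure"
  assumes P: "P \<in> space (prob_algebra borel)" and Q: "Q \<in> space (prob_algebra borel)" and a: "0 < a" "a < 1"
  shows "renyi_simple a P Q \<le> ereal c \<longleftrightarrow> (\<forall>(G, r)\<in>renyi_halfspaces Q c a. integral\<^sup>L P G \<le> r)"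
proof -
  interpret density_pair "mixture (1/2) P Q" P Q "\<lambda>x. enn2real (RN_deriv (mixture (1/2) P Q) P x)"
      "\<lambda>x. enn2real (RN_deriv (mixture (1/2) P Q) Q x)"
    by (rule density_pair_mixture[OF P Q])
  let ?H = "\<lambda>g :: 'a \<Rightarrow> real. exp ((a - 1) * c) \<le> (\<integral>x. a * g x powr (a - 1) \<partial>P) + (1 - a) * (\<integral>x. g x powr a \<partial>Q)"
  have "renyi_simple a P Q \<le> ereal c \<longleftrightarrow> ennreal (exp ((a - 1) * c)) \<le> I a"
    using ln_ennreal_le_iff_lt[OF a(2)] by (simp add: renyi_simple_def renyi_simple_wrt_def Let_def)
  also have "\<dots> \<longleftrightarrow> (\<forall>g e. bounded_measurable g \<and> 0 < e \<and> (\<forall>x. e \<le> g x) \<longrightarrow> ?H g)"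
  proof (intro iffI allI impI)
    fix g :: "'a \<Rightarrow> real" and e :: real
    assume K: "ennreal (exp ((a - 1) * c)) \<le> I a" and g: "bounded_measurable g \<and> 0 < e \<and> (\<forall>x. e \<le> g x)"
    then have "ennreal (exp ((a - 1) * c)) \<le>
        ennreal ((\<integral>x. a * g x powr (a - 1) \<partial>P) + (1 - a) * (\<integral>x. g x powr a \<partial>Q))"
      using I_lt_le[OF a, of e g] order_trans by blast
    then show "?H g"
      using a by (subst (asm) ennreal_le_iff) (auto intro!: add_nonneg_nonneg mult_nonneg_nonneg integral_nonneg_AE)
  next
    assume "\<forall>g e. bounded_measurable g \<and> 0 < e \<and> (\<forall>x. e \<le> g x) \<longrightarrow> ?H g"
    then show "ennreal (exp ((a - 1) * c)) \<le> I a"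
      by (intro I_ltI[OF a]) blast
  qed
  also have "\<dots> \<longleftrightarrow> (\<forall>(G, r)\<in>renyi_halfspaces Q c a. integral\<^sup>L P G \<le> r)"
  proof -
    have "renyi_halfspaces Q c a = (\<lambda>g. (\<lambda>x. - a * g x powr (a - 1), (1 - a) * (\<integral>x. g x powr a \<partial>Q) - exp ((a - 1) * c))) `
        {g. bounded_measurable g \<and> (\<exists>e>0. \<forall>x. e \<le> g x)}"
      using a unfolding renyi_halfspaces_def by auto
    then show ?thesis by (auto simp: algebra_simps)
  qed
  finally show ?thesis .
qed

text \<open>Values in \<open>ereal\<close> are compared through their real upper bounds
  \<open>z\<close>, each of which \<open>I_gt_mono\<close> transfers.\<close>

lemma renyi_simple_mono_gt:
  assumes P: "P \<in> space (prob_algebra borel)" and Q: "Q \<in> space (prob_algebra borel)"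
    and a: "1 < a" "a \<le> b"
  shows "renyi_simple a P Q \<le> renyi_simple b P Q"
proof (cases "a = b")
  case False
  interpret density_pair "mixture (1/2) P Q" P Q "\<lambda>x. enn2real (RN_deriv (mixture (1/2) P Q) P x)"
      "\<lambda>x. enn2real (RN_deriv (mixture (1/2) P Q) Q x)"
    by (rule density_pair_mixture[OF P Q])
  have ab: "a < b" "1 < b" using a False by auto
  show ?thesis
  proof (rule ereal_le_real)
    fix z
    assume "renyi_simple b P Q \<le> ereal z"
    then show "renyi_simple a P Q \<le> ereal z"
      using I_gt_mono[OF a(1) ab(1), of z]
      unfolding renyi_simple_def renyi_simple_wrt_def Let_def ln_ennreal_le_iff_gt[OF a(1)] ln_ennreal_le_iff_gt[OF ab(2)]
      by blast
  qed
qed simp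

lemma renyi_simple_mono_lt:
  assumes P: "P \<in> space (prob_algebra borel)" and Q: "Q \<in> space (prob_algebra borel)"
    and a: "0 < a" "a \<le> b" "b < 1"
  shows "renyi_simple a P Q \<le> renyi_simple b P Q"
proof (cases "a = b")
  case False
  interpret density_pair "mixture (1/2) P Q" P Q "\<lambda>x. enn2real (RN_deriv (mixture (1/2) P Q) P x)"
      "\<lambda>x. enn2real (RN_deriv (mixture (1/2) P Q) Q x)"
    by (rule density_pair_mixture[OF P Q])
  have ab: "a < b" "a < 1" using a False by auto
  show ?thesis
  proof (rule ereal_le_real)
    fix z
    assume "renyi_simple b P Q \<le> ereal z"
    then show "renyi_simple a P Q \<le> ereal z"
      using I_lt_mono[OF a(1) ab(1) a(3), of z]
      unfolding renyi_simple_def renyi_simple_wrt_def Let_def ln_ennreal_le_iff_lt[OF a(3)] ln_ennreal_le_iff_lt[OF ab(2)]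
      by blast
  qed
qed simp

text \<open>\<open>D\<^sub>a\<close> increases with \<open>a\<close>, so bounding the limit defining \<open>D\<^sub>1\<close> or \<open>D\<^sub>\<infinity>\<close> means bounding
  \<open>D\<^sub>a\<close> for all orders in this set.\<close>

definition renyi_orders :: "ereal \<Rightarrow> real set" where
  "renyi_orders \<alpha> = (if \<alpha> = 1 then {0<..<1} else if \<alpha> = \<infinity> then {1<..} else {real_of_ereal \<alpha>})"

lemma renyi_divergence_le_iff:
  assumes P: "P \<in> space (prob_algebra borel)" and Q: "Q \<in> space (prob_algebra borel)" and \<alpha>: "1 \<le> \<alpha>"
  shows "renyi_divergence \<alpha> P Q \<le> c \<longleftrightarrow> (\<forall>a\<in>renyi_orders \<alpha>. renyi_simple a P Q \<le> c)"
proof -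
  have "Lim (at_left 1) (\<lambda>a. renyi_simple a P Q) \<le> c \<longleftrightarrow> (\<forall>a\<in>{0<..<1}. renyi_simple a P Q \<le> c)"
  proof (rule Lim_mono_le_iff)
    show "eventually (\<lambda>a. a \<in> {0<..<1}) (at_left (1::real))"
      by (rule eventually_at_left_real) simp
    show "eventually (\<lambda>b. a \<le> b) (at_left 1)" if "a \<in> {0<..<1}" for a :: real
      using eventually_at_left_real[of a 1] that by (auto elim: eventually_mono)
  qed (auto intro: renyi_simple_mono_lt[OF P Q])
  moreover have "Lim at_top (\<lambda>a. renyi_simple a P Q) \<le> c \<longleftrightarrow> (\<forall>a\<in>{1<..}. renyi_simple a P Q \<le> c)"
    by (rule Lim_mono_le_iff) (auto intro: renyi_simple_mono_gt[OF P Q] eventually_gt_at_top eventually_ge_at_top)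
  ultimately show ?thesis by (auto simp: renyi_divergence_def renyi_orders_def)
qed

lemma renyi_orders_cases:
  assumes "1 \<le> \<alpha>" "a \<in> renyi_orders \<alpha>"
  shows "0 < a \<and> a < 1 \<or> 1 < a"
  using assms by (cases \<alpha>) (auto simp: renyi_orders_def one_ereal_def split: if_splits)

lemma renyi_sublevel_eq_halfspaces:
  assumes Q: "Q \<in> space (prob_algebra borel)" and \<alpha>: "1 \<le> \<alpha>"
  shows "{P \<in> space (prob_algebra borel). renyi_divergence \<alpha> P Q \<le> ereal c} =
    halfspaces (\<Union>a\<in>renyi_orders \<alpha>. renyi_halfspaces Q c a)"
proof -
  have "renyi_divergence \<alpha> P Q \<le> ereal c \<longleftrightarrow>
      (\<forall>a\<in>renyi_orders \<alpha>. \<forall>(G, r)\<in>renyi_halfspaces Q c a. integral\<^sup>L P G \<le> r)"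
    if P: "P \<in> space (prob_algebra borel)" for P
    unfolding renyi_divergence_le_iff[OF P Q \<alpha>]
    using renyi_simple_le_iff_gt[OF P Q] renyi_simple_le_iff_lt[OF P Q] renyi_orders_cases[OF \<alpha>]
    by (intro ball_cong refl) blast
  then show ?thesis unfolding halfspaces_def by blast
qed

section \<open>Uniform absolute continuity with respect to Q\<close>

lemma integral_two_valued:
  assumes P: "P \<in> space (prob_algebra borel)" and A: "A \<in> sets borel"
  shows "(\<integral>x. (if x \<in> A then u else v) \<partial>P) = v + (u - v) * measure P A"
proof -
  interpret prob_space P using P by (simp add: space_prob_algebra)
  have s: "sets P = sets borel" using P by (simp add: space_prob_algebra)
  have "(\<integral>x. (if x \<in> A then u else v) \<partial>P) = (\<integral>x. v + (u - v) * indicator A x \<partial>P)"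
    by (intro Bochner_Integration.integral_cong) auto
  also have "\<dots> = v + (u - v) * measure P A"
    using A s by (subst Bochner_Integration.integral_add) (auto simp: prob_space emeasure_eq_measure intro!: integrable_real_indicator)
  finally show ?thesis .
qed

text \<open>The test function is \<open>v\<close> on \<open>A\<close> and 0 elsewhere. As
  \<open>1 - a < 0\<close>, a large \<open>v\<close> makes the first term small, and then small
  \<open>Q\<close>-measure handles the second.\<close>

lemma renyi_halfspaces_gt_measure_le:
  assumes P: "P \<in> space (prob_algebra borel)" and Q: "Q \<in> space (prob_algebra borel)" and a: "1 < a"
    and H: "\<forall>(G, r)\<in>renyi_halfspaces Q c a. integral\<^sup>L P G \<le> r"
    and A: "A \<in> sets borel" and v: "0 < v"
  shows "measure P A \<le> exp ((a - 1) * c) * v powr (1 - a) + v * measure Q A"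
proof -
  let ?g = "\<lambda>x. if x \<in> A then v else 0"
  have "(\<integral>x. a * ?g x powr (a - 1) \<partial>P) \<le> exp ((a - 1) * c) + (a - 1) * (\<integral>x. ?g x powr a \<partial>Q)"
  proof -
    have "(\<lambda>x. a * ?g x powr (a - 1), exp ((a - 1) * c) + (a - 1) * (\<integral>x. ?g x powr a \<partial>Q)) \<in> renyi_halfspaces Q c a"
      using bounded_measurable_two_valued[OF A, of v 0] a v by (auto simp: renyi_halfspaces_def)
    then show ?thesis using H by blast
  qed
  moreover have "?g x powr b = (if x \<in> A then v powr b else 0)" if "b \<noteq> 0" for x b by simp
  ultimately have "a * (v powr (a - 1) * measure P A) \<le> exp ((a - 1) * c) + (a - 1) * (v powr a * measure Q A)"
    using a by (simp add: integral_two_valued[OF P A] integral_two_valued[OF Q A])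
  \<comment> \<open>The factors 1 and \<open>a - 1\<close> are both enlarged to \<open>a\<close>,
    which then cancels.\<close>
  also have "\<dots> \<le> a * (exp ((a - 1) * c) + v powr a * measure Q A)"
  proof -
    have "1 * exp ((a - 1) * c) \<le> a * exp ((a - 1) * c)" "(a - 1) * (v powr a * measure Q A) \<le> a * (v powr a * measure Q A)"
      using a by (intro mult_right_mono; simp)+
    then show ?thesis by (simp only: distrib_left mult_1)
  qed
  finally have "v powr (a - 1) * measure P A \<le> exp ((a - 1) * c) + v powr a * measure Q A"
    using a by simp
  then have "v powr (1 - a) * (v powr (a - 1) * measure P A) \<le> v powr (1 - a) * (exp ((a - 1) * c) + v powr a * measure Q A)"
    by (intro mult_left_mono) auto
  then show ?thesis using v
    by (simp add: mult.assoc[symmetric] powr_add[symmetric] distrib_left) (simp add: algebra_simps)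
qed

lemma renyi_halfspaces_lt_measure_le:
  assumes P: "P \<in> space (prob_algebra borel)" and Q: "Q \<in> space (prob_algebra borel)" and a: "0 < a" "a < 1"
    and H: "\<forall>(G, r)\<in>renyi_halfspaces Q c a. integral\<^sup>L P G \<le> r"
    and A: "A \<in> sets borel"
  shows "a * measure P A \<le> 2 * (1 - a) * (c + 2 powr (a / (1 - a)) * measure Q A)"
proof -
  \<comment> \<open>chosen so that \<open>v powr (a - 1) = 1/2\<close> whatever \<open>a\<close> is: as \<open>a \<rightarrow> 1\<close> the bound on \<open>P A\<close> becomes
    arbitrarily small once \<open>Q A\<close> is small\<close>
  define v :: real where "v = 2 powr (1 / (1 - a))"
  have v: "0 < v" by (simp add: v_def)
  have v1: "v powr (a - 1) = 1 / 2"
  proof -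
    have "1 / (1 - a) * (a - 1) = - 1" using a by (simp add: field_simps)
    then show ?thesis by (simp add: v_def powr_powr powr_minus_divide)
  qed
  have v2: "v powr a = 2 powr (a / (1 - a))" by (simp add: v_def powr_powr)
  \<comment> \<open>With the value 1 off \<open>A\<close> the constant terms cancel up to
    \<open>1 - exp ((a - 1) * c)\<close>, which is at most \<open>(1 - a) * c\<close>.\<close>
  let ?g = "\<lambda>x. if x \<in> A then v else 1"
  have "(\<integral>x. - a * ?g x powr (a - 1) \<partial>P) \<le> (1 - a) * (\<integral>x. ?g x powr a \<partial>Q) - exp ((a - 1) * c)"
  proof -
    have "\<exists>e>0. \<forall>x. e \<le> ?g x" using v by (intro exI[of _ "min v 1"]) auto
    then have "(\<lambda>x. - a * ?g x powr (a - 1), (1 - a) * (\<integral>x. ?g x powr a \<partial>Q) - exp ((a - 1) * c)) \<in> renyi_halfspaces Q c a"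
      using bounded_measurable_two_valued[OF A, of v 1] a unfolding renyi_halfspaces_def by auto
    then show ?thesis using H by blast
  qed
  moreover have "?g x powr b = (if x \<in> A then v powr b else 1)" for x b by simp
  ultimately have "- (a * (1 - measure P A / 2)) \<le> (1 - a) * (1 + (v powr a - 1) * measure Q A) - exp ((a - 1) * c)"
    by (simp add: integral_two_valued[OF P A] integral_two_valued[OF Q A] v1)
  moreover have "1 + (a - 1) * c \<le> exp ((a - 1) * c)" by (rule exp_ge_add_one_self)
  moreover have "0 \<le> (1 - a) * measure Q A" using a by simp
  ultimately show ?thesis by (simp add: v2 algebra_simps)
qed

lemma renyi_sublevel_equi_ac:
  assumes Q: "Q \<in> space (prob_algebra borel)" and \<alpha>: "1 \<le> \<alpha>" and \<epsilon>: "0 < \<epsilon>"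
  shows "\<exists>\<delta>>0. \<forall>P\<in>halfspaces (\<Union>a\<in>renyi_orders \<alpha>. renyi_halfspaces Q c a). \<forall>A\<in>sets borel.
    measure Q A < \<delta> \<longrightarrow> measure P A \<le> \<epsilon>"
proof (cases "\<alpha> = 1")
  case True
  \<comment> \<open>The order \<open>a\<close> is fixed first, with \<open>c + 1\<close> in place of
    \<open>c\<close>: the extra 1 is room for the \<open>Q\<close>-term, and \<delta> is then chosen
    to keep that term below 1.\<close>
  have "((\<lambda>a::real. 2 * (1 - a) * (c + 1) / a) \<longlongrightarrow> 2 * (1 - 1) * (c + 1) / 1) (at_left 1)"
    by (intro tendsto_intros) auto
  then have "eventually (\<lambda>a::real. 2 * (1 - a) * (c + 1) / a < \<epsilon>) (at_left 1)"
    by (rule order_tendstoD(2)) (use \<epsilon> in simp)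
  moreover have "eventually (\<lambda>a::real. a \<in> {0<..<1}) (at_left 1)"
    by (rule eventually_at_left_real) simp
  ultimately have "eventually (\<lambda>a::real. a \<in> {0<..<1} \<and> 2 * (1 - a) * (c + 1) / a < \<epsilon>) (at_left 1)"
    by eventually_elim simp
  from eventually_happens[OF this]
  obtain a :: real where a: "0 < a" "a < 1" "2 * (1 - a) * (c + 1) / a < \<epsilon>"
    by auto
  define \<delta> :: real where "\<delta> = 1 / 2 powr (a / (1 - a))"
  have "measure P A \<le> \<epsilon>"
    if P: "P \<in> halfspaces (\<Union>a\<in>renyi_orders \<alpha>. renyi_halfspaces Q c a)" and A: "A \<in> sets borel" and q: "measure Q A < \<delta>" for P A
  proof -
    have "a * measure P A \<le> 2 * (1 - a) * (c + 2 powr (a / (1 - a)) * measure Q A)"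
      using P Q A a True by (intro renyi_halfspaces_lt_measure_le) (auto simp: halfspaces_def renyi_orders_def)
    also have "\<dots> \<le> 2 * (1 - a) * (c + 1)"
      using a q by (intro mult_left_mono add_left_mono) (auto simp: \<delta>_def field_simps)
    also have "\<dots> \<le> a * \<epsilon>" using a by (simp add: field_simps)
    finally show ?thesis using a by simp
  qed
  then show ?thesis by (intro exI[of _ \<delta>]) (auto simp: \<delta>_def)
next
  case False
  obtain a where a: "1 < a" "a \<in> renyi_orders \<alpha>"
  proof (cases "\<alpha> = \<infinity>")
    case True
    then show ?thesis using that[of 2] by (simp add: renyi_orders_def)
  next
    case False
    then show ?thesis using \<open>\<alpha> \<noteq> 1\<close> \<alpha> that[of "real_of_ereal \<alpha>"]
      by (cases \<alpha>) (auto simp: renyi_orders_def one_ereal_def)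
  qed
  \<comment> \<open>First \<open>v\<close> is chosen for one half of \<epsilon>, then \<delta> as
    \<open>\<epsilon> / (2 * v)\<close> for the other half.\<close>
  have "((\<lambda>v. exp ((a - 1) * c) * v powr (1 - a)) \<longlongrightarrow> 0) at_top"
    using a by real_asymp
  then have "eventually (\<lambda>v. exp ((a - 1) * c) * v powr (1 - a) < \<epsilon> / 2) at_top"
    by (rule order_tendstoD(2)) (use \<epsilon> in simp)
  then have "eventually (\<lambda>v. 0 < v \<and> exp ((a - 1) * c) * v powr (1 - a) < \<epsilon> / 2) at_top"
    using eventually_gt_at_top[of 0] by eventually_elim simp
  from eventually_happens[OF this]
  obtain v where v: "0 < v" "exp ((a - 1) * c) * v powr (1 - a) < \<epsilon> / 2"
    by auto
  have "measure P A \<le> \<epsilon>"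
    if P: "P \<in> halfspaces (\<Union>a\<in>renyi_orders \<alpha>. renyi_halfspaces Q c a)" and A: "A \<in> sets borel" and q: "measure Q A < \<epsilon> / (2 * v)" for P A
  proof -
    have "measure P A \<le> exp ((a - 1) * c) * v powr (1 - a) + v * measure Q A"
      using P Q A a v by (intro renyi_halfspaces_gt_measure_le) (auto simp: halfspaces_def)
    moreover have "v * measure Q A \<le> \<epsilon> / 2" using q v by (simp add: field_simps)
    ultimately show ?thesis using v by simp
  qed
  then show ?thesis using \<epsilon> v by (intro exI[of _ "\<epsilon> / (2 * v)"]) auto
qed

theorem theorem20:
  fixes Q :: "'a::polish_space measure" and c :: real and \<alpha> :: ereal
  assumes "Q \<in> space (prob_algebra borel)" and "0 \<le> c" and "1 \<le> \<alpha>"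
    and "S = {P \<in> space (prob_algebra borel). renyi_divergence \<alpha> P Q \<le> ereal c}"
  shows "convex_measures S \<and> compactin weak_topology S"
proof -
  let ?H = "\<Union>a\<in>renyi_orders \<alpha>. renyi_halfspaces Q c a"
  have S: "S = halfspaces ?H"
    using assms(4) renyi_sublevel_eq_halfspaces[OF assms(1,3)] by simp
  have bm: "bounded_measurable G" if "(G, r) \<in> ?H" for G r
    using that renyi_halfspaces_bounded_measurable[of G r Q c] renyi_orders_cases[OF assms(3)] by auto
  \<comment> \<open>The implication stands inside the existential so that \<open>choice\<close>
    gives \<delta> as a total function.\<close>
  have "\<forall>\<epsilon>. \<exists>\<delta>. 0 < \<epsilon> \<longrightarrow> 0 < \<delta> \<and>
      (\<forall>P\<in>halfspaces ?H. \<forall>A\<in>sets borel. measure Q A < \<delta> \<longrightarrow> measure P A \<le> \<epsilon>)"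
    using renyi_sublevel_equi_ac[OF assms(1,3)] by blast
  from choice[OF this] obtain \<delta> :: "real \<Rightarrow> real" where d: "\<And>\<epsilon>. 0 < \<epsilon> \<Longrightarrow> 0 < \<delta> \<epsilon> \<and>
      (\<forall>P\<in>halfspaces ?H. \<forall>A\<in>sets borel. measure Q A < \<delta> \<epsilon> \<longrightarrow> measure P A \<le> \<epsilon>)"
    by blast
  interpret equi_ac Q \<delta>
  proof
    show "0 < \<delta> \<epsilon>" if "0 < \<epsilon>" for \<epsilon> using d[OF that] by (rule conjunct1)
  qed fact
  have "compactin weak_topology (halfspaces ?H)"
  proof (rule compactin_halfspaces[OF bm])
    show "measure P A \<le> \<epsilon>"
      if "P \<in> halfspaces ?H" "A \<in> sets borel" "0 < \<epsilon>" "measure Q A < \<delta> \<epsilon>" for P A \<epsilon>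
      using d[OF that(3)] that(1,2,4) by blast
  qed
  moreover have "convex_measures (halfspaces ?H)" by (rule convex_halfspaces[OF bm])
  ultimately show ?thesis unfolding S by simp
qed

end
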